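(* Let $X$ be a Hilbert space, let $A$ be the infinitesimal generator of a linear $C_0$-semigroup of contractions $(S(t))_{t\ge 0}$ on $X$, and let $B\in\mathcal{L}(X,X_{-1})$. Assume that for some $T>0$ the following hold: (i) there exists $1<p<\infty$ such that $\displaystyle\int_0^T S_{-1}(T-s)Bu(s)\,ds\in X$ for all $u\in L^p(0,T;X)$; (ii) for some $\delta>0$, $$\int_0^T \mathrm{Re}\,\langle S(t)x,\,B^*S(t)x\rangle_X\,dt\ \ge\ \delta\,\|S(T)x\|_X^2,\qquad \forall x\in X.$$ Then there is a $\rho_1>0$ such that for all $\rho\in(0,\rho_1)$ the system $\dot x(t)=Ax(t)-\rho Bx(t)$ $(t>0)$, $x(0)=x_0$, is exponentially stable on $X$; that is, for each such $\rho$ there exist constants $K,\sigma>0$ such that for every $x_0\in X$ the mild solution satisfies $\|x(t)\|_X\le Ke^{-\sigma t}\|x_0\|_X$ for all $t\ge 0$.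
   Context: $X$ is a Hilbert space with inner product $\langle\cdot,\cdot\rangle_X$ and norm $\|\cdot\|_X$. Extrapolation space: fix $\lambda$ in the resolvent set of $A$. $X_{-1}$ is the completion of $X$ for the norm $\|x\|_{-1}:=\|(\lambda I-A)^{-1}x\|_X$ (different $\lambda$ give equivalent norms); it is a Hilbert space and $X$ embeds continuously and densely in it. $A$ extends to an operator $A_{-1}\in\mathcal{L}(X,X_{-1})$, and $S(t)$ extends to a $C_0$-semigroup $S_{-1}(t)$ on $X_{-1}$ with generator $A_{-1}$, whose domain is $D(A_{-1})=X$. The integral in (i) is an $X_{-1}$-valued integral. Adjoint: $B^*\in\mathcal{L}(X_{-1},X)$ denotes the adjoint of $B\in\mathcal{L}(X,X_{-1})$; elements of $X$ are regarded as elements of $X_{-1}$ when $B^*$ is applied to them. Solutions: under (i), for every $\rho>0$ the part $(A_{-1}-\rho B)|_X$ of $A_{-1}-\rho B$ in $X$, with domain $\{x\in X: (A_{-1}-\rho B)x\in X\}$, generates a $C_0$-semigroup $(T(t))_{t\ge0}$ on $X$. The mild solution of the system with initial state $x_0\in X$ is $x(t)=T(t)x_0$; it satisfies $x(t)=S(t)x_0-\rho\int_0^t S_{-1}(t-s)Bx(s)\,ds$ for $t\ge 0$. *)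

theory Defs
  imports "HOL-Analysis.Analysis"
begin

text \<open>
  Complex Hilbert spaces. The inner product is linear in the first argument; the norm, metric and
  topology are those of the real inner product \<open>Re \<langle>x, y\<rangle>\<close>, so \<open>norm x = sqrt (Re \<langle>x, x\<rangle>)\<close>.
\<close>

class chilbert_space = real_inner + complete_space +
  fixes scaleC :: "complex \<Rightarrow> 'a \<Rightarrow> 'a" (infixr "*\<^sub>C" 75)
    and cinner :: "'a \<Rightarrow> 'a \<Rightarrow> complex"
  assumes scaleC_add_right: "c *\<^sub>C (x + y) = c *\<^sub>C x + c *\<^sub>C y"
    and scaleC_add_left: "(c + d) *\<^sub>C x = c *\<^sub>C x + d *\<^sub>C x"
    and scaleC_scaleC: "c *\<^sub>C d *\<^sub>C x = (c * d) *\<^sub>C x"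
    and scaleC_complex_of_real: "complex_of_real r *\<^sub>C x = r *\<^sub>R x"
    and cinner_commute: "cinner x y = cnj (cinner y x)"
    and cinner_add_left: "cinner (x + y) z = cinner x z + cinner y z"
    and cinner_scaleC_left: "cinner (c *\<^sub>C x) y = c * cinner x y"
    and Re_cinner: "Re (cinner x y) = inner x y"

instantiation complex :: chilbert_space
begin

definition scaleC_complex :: "complex \<Rightarrow> complex \<Rightarrow> complex"
  where "scaleC_complex c x = c * x"

definition cinner_complex :: "complex \<Rightarrow> complex \<Rightarrow> complex"
  where "cinner_complex x y = x * cnj y"

instance
  by standard
    (auto simp: scaleC_complex_def cinner_complex_def algebra_simps scaleR_conv_of_real
      inner_complex_def)

end

definition clinear :: "('a::chilbert_space \<Rightarrow> 'b::chilbert_space) \<Rightarrow> bool"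
  where "clinear f \<longleftrightarrow> linear f \<and> (\<forall>c x. f (c *\<^sub>C x) = c *\<^sub>C f x)"

definition bounded_clinear :: "('a::chilbert_space \<Rightarrow> 'b::chilbert_space) \<Rightarrow> bool"
  where "bounded_clinear f \<longleftrightarrow> bounded_linear f \<and> (\<forall>c x. f (c *\<^sub>C x) = c *\<^sub>C f x)"

definition is_cadjoint ::
    "('a::chilbert_space \<Rightarrow> 'b::chilbert_space) \<Rightarrow> ('b \<Rightarrow> 'a) \<Rightarrow> bool"
  where "is_cadjoint B B' \<longleftrightarrow>
    bounded_clinear B' \<and> (\<forall>x z. cinner (B x) z = cinner x (B' z))"

definition C0_semigroup :: "(real \<Rightarrow> 'a::chilbert_space \<Rightarrow> 'a) \<Rightarrow> bool"
  where "C0_semigroup S \<longleftrightarrow>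
    (\<forall>t\<ge>0. bounded_clinear (S t)) \<and>
    (\<forall>x. S 0 x = x) \<and>
    (\<forall>s\<ge>0. \<forall>t\<ge>0. \<forall>x. S (s + t) x = S s (S t x)) \<and>
    (\<forall>x. ((\<lambda>t. S t x) \<longlongrightarrow> x) (at_right 0))"

definition contraction_semigroup :: "(real \<Rightarrow> 'a::chilbert_space \<Rightarrow> 'a) \<Rightarrow> bool"
  where "contraction_semigroup S \<longleftrightarrow>
    C0_semigroup S \<and> (\<forall>t\<ge>0. \<forall>x. norm (S t x) \<le> norm x)"

text \<open>
  An unbounded operator on \<open>X\<close> is represented by its graph, a set of pairs \<open>(x, A x)\<close> with \<open>x\<close> in
  the domain; equality of graphs includes equality of domains.
\<close>

definition generator :: "(real \<Rightarrow> 'a::chilbert_space \<Rightarrow> 'a) \<Rightarrow> ('a \<times> 'a) set"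
  where "generator S = {(x, y). ((\<lambda>t. (S t x - x) /\<^sub>R t) \<longlongrightarrow> y) (at_right 0)}"

definition resolvent :: "('a::chilbert_space \<times> 'a) set \<Rightarrow> complex \<Rightarrow> 'a \<Rightarrow> 'a"
  where "resolvent A \<mu> z = (THE x. \<exists>y. (x, y) \<in> A \<and> \<mu> *\<^sub>C x - y = z)"

definition resolvent_set :: "('a::chilbert_space \<times> 'a) set \<Rightarrow> complex set"
  where "resolvent_set A =
    {\<mu>. (\<forall>z. \<exists>!x. \<exists>y. (x, y) \<in> A \<and> \<mu> *\<^sub>C x - y = z) \<and> bounded_clinear (resolvent A \<mu>)}"

text \<open>
  The type \<open>'b\<close>, which is complete, together with the embedding \<open>j\<close> is a completion of \<open>'a\<close> for the
  norm \<open>x \<mapsto> norm (resolvent A \<mu> x)\<close>. This determines \<open>('b, j)\<close> up to a unique isometric isomorphism,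
  including the inner product of \<open>'b\<close> (by polarization). Elements of \<open>X\<close> are regarded as elements
  of \<open>X\<^sub>-\<^sub>1\<close> through \<open>j\<close>, and an element of \<open>X\<^sub>-\<^sub>1\<close> belongs to \<open>X\<close> iff it lies in the range of \<open>j\<close>.
\<close>

definition extrapolation_space ::
    "('a::chilbert_space \<times> 'a) set \<Rightarrow> complex \<Rightarrow> ('a \<Rightarrow> 'b::chilbert_space) \<Rightarrow> bool"
  where "extrapolation_space A \<mu> j \<longleftrightarrow>
    clinear j \<and> (\<forall>x. norm (j x) = norm (resolvent A \<mu> x)) \<and> closure (range j) = UNIV"

text \<open>
  The bounded extensions of \<open>A\<close> and of \<open>S t\<close>; they are unique because the domain of \<open>A\<close> is dense in
  \<open>X\<close> and the range of \<open>j\<close> is dense in \<open>X\<^sub>-\<^sub>1\<close>.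
\<close>

definition extends_operator ::
    "('a::chilbert_space \<Rightarrow> 'b::chilbert_space) \<Rightarrow> ('a \<times> 'a) set \<Rightarrow> ('a \<Rightarrow> 'b) \<Rightarrow> bool"
  where "extends_operator j A A1 \<longleftrightarrow>
    bounded_clinear A1 \<and> (\<forall>(x, y)\<in>A. A1 x = j y)"

definition extends_semigroup ::
    "('a::chilbert_space \<Rightarrow> 'b::chilbert_space) \<Rightarrow> (real \<Rightarrow> 'a \<Rightarrow> 'a) \<Rightarrow> (real \<Rightarrow> 'b \<Rightarrow> 'b) \<Rightarrow> bool"
  where "extends_semigroup j S S1 \<longleftrightarrow>
    (\<forall>t\<ge>0. bounded_clinear (S1 t) \<and> (\<forall>x. S1 t (j x) = j (S t x)))"

definition part_in :: "('a \<Rightarrow> 'b) \<Rightarrow> ('a \<Rightarrow> 'b) \<Rightarrow> ('a \<times> 'a) set"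
  where "part_in j F = {(x, y). F x = j y}"

text \<open>
  Bochner measurability: for a non-separable range it is stronger than Borel measurability.
\<close>

definition strongly_measurable :: "'c measure \<Rightarrow> ('c \<Rightarrow> 'a::real_normed_vector) \<Rightarrow> bool"
  where "strongly_measurable M u \<longleftrightarrow>
    (\<exists>s. (\<forall>n::nat. simple_function M (s n)) \<and> (AE x in M. (\<lambda>n. s n x) \<longlonglongrightarrow> u x))"

text \<open>Functions are not identified almost everywhere.\<close>

definition Lp_fun :: "real \<Rightarrow> real \<Rightarrow> (real \<Rightarrow> 'a::real_normed_vector) set"
  where "Lp_fun p T =
    {u. strongly_measurable (lebesgue_on {0..T}) u \<and>
        integrable (lebesgue_on {0..T}) (\<lambda>s. norm (u s) powr p)}"

text \<open>
  The vector-valued integral in the admissibility condition is the gauge integral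
  \<^const>\<open>integral\<close>, as the library's Bochner integral is restricted to separable spaces. For
  \<open>u \<in> Lp_fun p T\<close> the integrand is strongly measurable with integrable norm, and for such functions
  the gauge integral exists and equals the Bochner integral.
\<close>

definition admissible ::
    "('a::chilbert_space \<Rightarrow> 'b::chilbert_space) \<Rightarrow> (real \<Rightarrow> 'b \<Rightarrow> 'b) \<Rightarrow> ('a \<Rightarrow> 'b) \<Rightarrow> real \<Rightarrow> real \<Rightarrow> bool"
  where "admissible j S1 B p T \<longleftrightarrow>
    (\<forall>u\<in>Lp_fun p T. integral {0..T} (\<lambda>s. S1 (T - s) (B (u s))) \<in> range j)"

text \<open>
  The system \<open>x' = F x\<close>, with \<open>F\<close> from \<open>X\<close> to \<open>X\<^sub>-\<^sub>1\<close>: the part of \<open>F\<close> in \<open>X\<close> generates a (necessarily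
  unique) \<open>C\<^sub>0\<close>-semigroup \<open>V\<close>, the mild solution for the initial state \<open>x0\<close> is \<open>t \<mapsto> V t x0\<close>, and
  these solutions decay exponentially at a uniform rate.
\<close>

definition exponentially_stable ::
    "('a::chilbert_space \<Rightarrow> 'b::chilbert_space) \<Rightarrow> ('a \<Rightarrow> 'b) \<Rightarrow> bool"
  where "exponentially_stable j F \<longleftrightarrow>
    (\<exists>V. C0_semigroup V \<and> generator V = part_in j F \<and>
      (\<exists>K>0. \<exists>\<sigma>>0. \<forall>x0. \<forall>t\<ge>0. norm (V t x0) \<le> K * exp (- \<sigma> * t) * norm x0))"

end

theory Submission
  imports Defs
begin

text \<open>
  The operator \<open>B\<close> takes values in \<open>X\<^sub>-\<^sub>1\<close>, and \<open>B\<^sup>*\<close> is the adjoint for the inner product of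
  \<open>X\<^sub>-\<^sub>1\<close>; hence \<open>Re \<langle>S(t)x, B\<^sup>* S(t)x\<rangle>\<^sub>X\<close> equals \<open>Re \<langle>B S(t)x, S(t)x\<rangle>\<^sub>-\<^sub>1\<close>. Up to
  the factor \<open>2\<rho>\<close> this is the rate at which the feedback \<open>- \<rho> B\<close> dissipates the squared norm of \<open>X\<^sub>-\<^sub>1\<close>, while the
  assumption bounds it from below by the norm of \<open>X\<close>. The Lyapunov functional of the problem is
  therefore \<open>\<phi>(x) = norm (j x)\<^sup>2\<close>, which is weaker than \<open>norm x\<^sup>2\<close> and need not decay
  by a fixed factor over a period. The proof shows instead that the sum of \<open>norm (x(kT))\<^sup>2\<close>
  over all \<open>k\<close> is finite, and concludes by Datko's argument.

  Three ingredients are combined.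

  Extrapolation space. The operator \<open>Q = \<mu> j - A1\<close> is an isometric isomorphism of \<open>X\<close> onto
  \<open>X\<^sub>-\<^sub>1\<close> (\<open>norm_Q\<close>, \<open>bij_Q\<close>) which conjugates \<open>S\<close> to \<open>S1\<close>. So \<open>S1\<close> is a \<open>C\<^sub>0\<close>-semigroup
  of contractions too (\<open>S1_contraction\<close>).

  Well-posedness. Admissibility is a qualitative statement (certain integrals lie in \<open>X\<close>). The
  uniform boundedness principle turns it into the estimate \<open>input_integral_bound\<close>: for continuous
  \<open>g\<close> with \<open>norm (g r) \<le> M\<close>, the \<open>X\<close>-norm of \<open>\<integral>\<^sub>0\<^sup>t S1(r) B g(r) dr\<close> is at most
  \<open>C t\<^sup>a M\<close> for some \<open>a > 0\<close> and all \<open>t \<le> T\<close>. The gain of a power of \<open>t\<close> comes from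
  testing with inputs that blow up like \<open>(T - s)\<^sup>-\<^sup>a\<close>, which still belong to \<open>L\<^sup>p\<close> when
  \<open>a p < 1\<close>. Given this estimate, the Volterra equation
  \<open>u(t) = S(t)x - \<rho> \<integral>\<^sub>0\<^sup>t S1(t-s) B u(s) ds\<close> is solved for small \<open>\<rho>\<close> by the contraction
  principle on the half line, in a space with weight \<open>e\<^sup>t\<close>. Its solutions form a \<open>C\<^sub>0\<close>-semigroup
  \<open>V\<close> whose generator is the part of \<open>A1 - \<rho> B\<close> in \<open>X\<close> (\<open>V_C0_semigroup\<close>, \<open>V_generator\<close>).

  Stability. Since \<open>S1\<close> is contractive, \<open>\<phi>(V(T)x) \<le> \<phi>(x) - 2\<rho> \<integral>\<^sub>0\<^sup>T Re \<langle>B V(s)x, V(s)x\<rangle>\<^sub>-\<^sub>1 ds\<close>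
  (\<open>energy_inequality\<close>). On \<open>[0,T]\<close> the semigroups \<open>V\<close> and \<open>S\<close> differ by \<open>O(\<rho>)\<close>, so the assumption
  on \<open>S\<close> yields \<open>\<phi>(V(T)x) \<le> \<phi>(x) - \<rho> \<delta> norm (V(T)x)\<^sup>2 + L \<rho>\<^sup>2 norm x\<^sup>2\<close> with \<open>L\<close>
  independent of \<open>\<rho>\<close> (\<open>Lyapunov_step\<close>). Summing along \<open>x, V(T)x, V(2T)x, \<dots>\<close> with \<open>L \<rho> < \<delta>\<close>
  bounds the sum of \<open>norm (V(kT)x)\<^sup>2\<close> by a multiple of \<open>norm x\<^sup>2\<close>, which forces exponential
  decay (\<open>discrete_Datko\<close>).
\<close>

section \<open>Strongly continuous semigroups on complex Hilbert spaces\<close>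

subclass (in chilbert_space) banach ..

lemma norm_scaleC: "norm (c *\<^sub>C x) = cmod c * norm (x::'a::chilbert_space)"
proof -
  have "cinner (c *\<^sub>C x) (c *\<^sub>C x) = (c * cnj c) * cinner x x"
    by (metis cinner_commute cinner_scaleC_left complex_cnj_mult mult.assoc)
  also have "c * cnj c = of_real ((cmod c)\<^sup>2)"
    using complex_norm_square[of c] by simp
  finally have "inner (c *\<^sub>C x) (c *\<^sub>C x) = (cmod c)\<^sup>2 * inner x x"
    by (simp flip: Re_cinner)
  then show ?thesis
    by (simp add: norm_eq_sqrt_inner real_sqrt_mult)
qed

lemma bounded_linear_scaleC: "bounded_linear (\<lambda>x::'a::chilbert_space. c *\<^sub>C x)"
proof
  fix b1 b2 :: 'a and r :: real
  show "c *\<^sub>C (b1 + b2) = c *\<^sub>C b1 + c *\<^sub>C b2" by (rule scaleC_add_right)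
  show "c *\<^sub>C (r *\<^sub>R b1) = r *\<^sub>R (c *\<^sub>C b1)"
    by (simp flip: scaleC_complex_of_real add: scaleC_scaleC mult.commute)
  show "\<exists>K. \<forall>x::'a. norm (c *\<^sub>C x) \<le> norm x * K"
    by (metis norm_scaleC mult.commute order_refl)
qed

lemma bounded_clinearD:
  assumes "bounded_clinear f"
  shows "bounded_linear f" "f (c *\<^sub>C x) = c *\<^sub>C f x"
  using assms by (auto simp: bounded_clinear_def)

lemma C0_semigroupD:
  assumes "C0_semigroup S"
  shows "t \<ge> 0 \<Longrightarrow> bounded_clinear (S t)" "t \<ge> 0 \<Longrightarrow> bounded_linear (S t)"
    "S 0 x = x" "s \<ge> 0 \<Longrightarrow> t \<ge> 0 \<Longrightarrow> S (s + t) x = S s (S t x)"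
    "((\<lambda>t. S t x) \<longlongrightarrow> x) (at_right 0)"
  using assms by (auto simp: C0_semigroup_def bounded_clinear_def)

lemma contraction_semigroupD:
  assumes "contraction_semigroup S"
  shows "C0_semigroup S" "t \<ge> 0 \<Longrightarrow> norm (S t x) \<le> norm x"
  using assms by (auto simp: contraction_semigroup_def)

text \<open>
  The difference of two points of an orbit is the image of an initial difference, so for a
  contraction semigroup continuity at \<open>0\<close> propagates to all times, from both sides.
\<close>
lemma contraction_semigroup_diff_le:
  assumes "contraction_semigroup S" "0 \<le> s" "s \<le> t"
  shows "norm (S t x - S s x) \<le> norm (S (t - s) x - x)"
proof -
  note C = contraction_semigroupD[OF assms(1)] and D = C0_semigroupD[OF contraction_semigroupD(1)[OF assms(1)]]
  interpret bounded_linear "S s" using D(2) assms by simp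
  have "S t x - S s x = S s (S (t - s) x - x)"
    using D(4)[of s "t - s" x] assms by (simp add: diff)
  then show ?thesis using C(2) assms by simp
qed

lemma contraction_semigroup_continuous:
  assumes S: "contraction_semigroup S"
  shows "continuous_on {0..} (\<lambda>t. S t x)"
  unfolding continuous_on_iff
proof (intro ballI allI impI)
  fix t e :: real assume t: "t \<in> {0..}" and e: "e > 0"
  have "((\<lambda>t. S t x) \<longlongrightarrow> x) (at_right 0)"
    using C0_semigroupD(5)[OF contraction_semigroupD(1)[OF S]] .
  then have "\<forall>\<^sub>F h in at_right 0. dist (S h x) x < e"
    using e by (rule tendstoD)
  then obtain d where d: "d > 0" "\<And>h. h > 0 \<Longrightarrow> h < d \<Longrightarrow> dist (S h x) x < e"
    unfolding eventually_at_right_field by auto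
  show "\<exists>d>0. \<forall>s\<in>{0..}. dist s t < d \<longrightarrow> dist (S s x) (S t x) < e"
  proof (intro exI[of _ d] conjI ballI impI d(1))
    fix s assume s: "s \<in> {0..}" "dist s t < d"
    consider "s = t" | "s < t" | "s > t" by linarith
    then show "dist (S s x) (S t x) < e"
    proof cases
      case 1 then show ?thesis using e by simp
    next
      case 2
      then have "norm (S t x - S s x) \<le> norm (S (t - s) x - x)"
        using s t contraction_semigroup_diff_le[OF S] by simp
      then show ?thesis using d(2)[of "t - s"] 2 s by (simp add: dist_norm norm_minus_commute)
    next
      case 3
      then have "norm (S s x - S t x) \<le> norm (S (s - t) x - x)"
        using s t contraction_semigroup_diff_le[OF S] by simp
      then show ?thesis using d(2)[of "s - t"] 3 s by (simp add: dist_norm)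
    qed
  qed
qed

lemma contraction_semigroup_continuous_on:
  fixes f :: "'c::topological_space \<Rightarrow> real"
  assumes S: "contraction_semigroup S"
    and f: "continuous_on X f" "\<And>z. z \<in> X \<Longrightarrow> 0 \<le> f z" and g: "continuous_on X g"
  shows "continuous_on X (\<lambda>z. S (f z) (g z))"
  unfolding continuous_on_def
proof
  fix z assume z: "z \<in> X"
  note C = contraction_semigroupD[OF S] and D = C0_semigroupD[OF contraction_semigroupD(1)[OF S]]
  have "continuous_on X (\<lambda>w. S (f w) (g z))"
    using continuous_on_compose2[OF contraction_semigroup_continuous[OF S] f(1)] f(2) by auto
  then have 1: "((\<lambda>w. S (f w) (g z)) \<longlongrightarrow> S (f z) (g z)) (at z within X)"
    using z by (simp add: continuous_on_def)
  have gz: "(g \<longlongrightarrow> g z) (at z within X)"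
    using g z by (simp add: continuous_on_def)
  have 2: "((\<lambda>w. S (f w) (g w) - S (f w) (g z)) \<longlongrightarrow> 0) (at z within X)"
  proof (rule Lim_null_comparison)
    show "((\<lambda>w. norm (g w - g z)) \<longlongrightarrow> 0) (at z within X)"
      using tendsto_norm[OF tendsto_diff[OF gz tendsto_const[of "g z"]]] by simp
    show "\<forall>\<^sub>F w in at z within X. norm (S (f w) (g w) - S (f w) (g z)) \<le> norm (g w - g z)"
      unfolding eventually_at_topological
    proof (intro exI[of _ UNIV] conjI ballI impI)
      fix w assume "w \<in> X"
      then have "0 \<le> f w" by (rule f(2))
      then show "norm (S (f w) (g w) - S (f w) (g z)) \<le> norm (g w - g z)"
        using C(2) linear_diff[OF bounded_linear.linear[OF D(2)]] by metis
    qed auto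
  qed
  show "((\<lambda>w. S (f w) (g w)) \<longlongrightarrow> S (f z) (g z)) (at z within X)"
    using tendsto_add[OF 2 1] by simp
qed

lemma integral_average_tendsto:
  fixes f :: "real \<Rightarrow> 'a::banach"
  assumes "continuous_on {t..} f"
  shows "((\<lambda>h. integral {t..t+h} f /\<^sub>R h) \<longlongrightarrow> f t) (at_right 0)"
proof (rule tendstoI)
  fix e :: real assume e: "e > 0"
  have "\<exists>d>0. \<forall>s\<in>{t..}. dist s t < d \<longrightarrow> dist (f s) (f t) < e/2"
    using assms e unfolding continuous_on_iff by (meson atLeast_iff half_gt_zero order_refl)
  then obtain d where d: "d > 0" "\<And>s. s \<ge> t \<Longrightarrow> dist s t < d \<Longrightarrow> dist (f s) (f t) < e/2" by auto
  show "\<forall>\<^sub>F h in at_right 0. dist (integral {t..t+h} f /\<^sub>R h) (f t) < e"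
    unfolding eventually_at_right_field
  proof (intro exI[of _ d] conjI allI impI d(1))
    fix h :: real assume h: "h > 0" "h < d"
    have c: "continuous_on {t..t+h} f" using assms by (rule continuous_on_subset) auto
    have "norm (integral {t..t+h} (\<lambda>s. f s - f t)) \<le> (e/2) * (t + h - t)"
      using h d(2) by (intro integral_bound continuous_intros c)
        (auto simp: dist_norm intro!: less_imp_le)
    also have "integral {t..t+h} (\<lambda>s. f s - f t) = integral {t..t+h} f - h *\<^sub>R f t"
      using h by (subst integral_diff) (auto intro!: integrable_continuous_real c)
    finally have "norm (integral {t..t+h} f - h *\<^sub>R f t) \<le> (e/2) * h" by simp
    moreover have "integral {t..t+h} f /\<^sub>R h - f t = (integral {t..t+h} f - h *\<^sub>R f t) /\<^sub>R h"
      using h by (simp add: scaleR_diff_right)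
    ultimately have "norm (integral {t..t+h} f /\<^sub>R h - f t) \<le> e/2"
      using h by (simp add: divide_inverse_commute[symmetric] pos_divide_le_eq)
    then show "dist (integral {t..t+h} f /\<^sub>R h) (f t) < e" using e by (simp add: dist_norm)
  qed
qed

text \<open>
  Shifting the interval of integration shows that the difference quotients of the orbit of
  \<open>\<integral>\<^sub>0\<^sup>t S(s)x ds\<close> are differences of two averages, at \<open>t\<close> and at \<open>0\<close>. This yields the density of the
  domain, and in \<open>S1_orbit\<close> it replaces differentiating orbits.
\<close>
lemma contraction_semigroup_integral_in_generator:
  assumes S: "contraction_semigroup S" and t: "t \<ge> 0"
  shows "(integral {0..t} (\<lambda>s. S s x), S t x - x) \<in> generator S"
proof -
  note D = C0_semigroupD[OF contraction_semigroupD(1)[OF S]]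
  have c: "continuous_on {0..} (\<lambda>s. S s x)" by (rule contraction_semigroup_continuous[OF S])
  have ci: "(\<lambda>s. S s x) integrable_on {a..b}" if "a \<ge> 0" for a b
    using c that by (intro integrable_continuous_real continuous_on_subset[OF c]) auto
  have eq: "(S h (integral {0..t} (\<lambda>s. S s x)) - integral {0..t} (\<lambda>s. S s x)) /\<^sub>R h
     = integral {t..t+h} (\<lambda>s. S s x) /\<^sub>R h - integral {0..0+h} (\<lambda>s. S s x) /\<^sub>R h" if h: "h > 0" for h
  proof -
    have "S h (integral {0..t} (\<lambda>s. S s x)) = integral {0..t} (S h \<circ> (\<lambda>s. S s x))"
      using h t by (intro integral_linear[symmetric] ci D(2)) auto
    also have "\<dots> = integral {0..t} (\<lambda>s. S (s + h) x)"
      using h D(4)[of h _ x] by (intro integral_cong) (simp add: add.commute)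
    also have "\<dots> = integral {h..t+h} (\<lambda>s. S s x)"
      using integral_shift_real_ivl[of h h "t+h" "\<lambda>s. S s x"] by simp
    finally have "S h (integral {0..t} (\<lambda>s. S s x)) = integral {h..t+h} (\<lambda>s. S s x)" .
    moreover have "integral {0..h} (\<lambda>s. S s x) + integral {h..t+h} (\<lambda>s. S s x) = integral {0..t+h} (\<lambda>s. S s x)"
      using h t by (intro Henstock_Kurzweil_Integration.integral_combine[OF _ _ ci]) auto
    moreover have "integral {0..t} (\<lambda>s. S s x) + integral {t..t+h} (\<lambda>s. S s x) = integral {0..t+h} (\<lambda>s. S s x)"
      using h t by (intro Henstock_Kurzweil_Integration.integral_combine[OF _ _ ci]) auto
    ultimately have "S h (integral {0..t} (\<lambda>s. S s x)) - integral {0..t} (\<lambda>s. S s x)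
        = integral {t..t+h} (\<lambda>s. S s x) - integral {0..h} (\<lambda>s. S s x)"
      by (metis add_diff_cancel_left add_diff_cancel_right add.commute)
    then show ?thesis by (simp flip: scaleR_diff_right)
  qed
  have "((\<lambda>h. integral {t..t+h} (\<lambda>s. S s x) /\<^sub>R h - integral {0..0+h} (\<lambda>s. S s x) /\<^sub>R h) \<longlongrightarrow> S t x - S 0 x) (at_right 0)"
    using t by (intro tendsto_diff integral_average_tendsto continuous_on_subset[OF c]) auto
  then have "((\<lambda>h. (S h (integral {0..t} (\<lambda>s. S s x)) - integral {0..t} (\<lambda>s. S s x)) /\<^sub>R h) \<longlongrightarrow> S t x - x) (at_right 0)"
    unfolding D(3) by (rule Lim_transform_eventually) (use eq in \<open>auto simp: eventually_at_right_field intro!: exI[of _ 1]\<close>)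
  then show ?thesis by (simp add: generator_def)
qed

lemma contraction_semigroup_generator_dense:
  assumes S: "contraction_semigroup S"
  shows "closure (fst ` generator S) = UNIV"
proof -
  have "x \<in> closure (fst ` generator S)" for x
  proof -
    note D = C0_semigroupD[OF contraction_semigroupD(1)[OF S]]
    have "((\<lambda>h. integral {0..0+h} (\<lambda>s. S s x) /\<^sub>R h) \<longlongrightarrow> S 0 x) (at_right 0)"
      by (rule integral_average_tendsto[OF contraction_semigroup_continuous[OF S]])
    moreover have "\<forall>\<^sub>F h in at_right 0. integral {0..0+h} (\<lambda>s. S s x) /\<^sub>R h \<in> closure (fst ` generator S)"
    proof -
      have "integral {0..0+h} (\<lambda>s. S s x) /\<^sub>R h \<in> fst ` generator S" if h: "h > 0" for h
      proof -
        have *: "(c *\<^sub>R y, c *\<^sub>R z) \<in> generator S" if "(y, z) \<in> generator S" for c y z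
        proof -
          have "((\<lambda>t. c *\<^sub>R ((S t y - y) /\<^sub>R t)) \<longlongrightarrow> c *\<^sub>R z) (at_right 0)"
            using that by (intro tendsto_intros) (simp add: generator_def)
          then have "((\<lambda>t. (S t (c *\<^sub>R y) - c *\<^sub>R y) /\<^sub>R t) \<longlongrightarrow> c *\<^sub>R z) (at_right 0)"
            by (rule Lim_transform_eventually)
              (auto simp: eventually_at_right_field linear_scale[OF bounded_linear.linear[OF D(2)]]
                 scaleR_diff_right mult.commute intro!: exI[of _ 1])
          then show ?thesis by (simp add: generator_def)
        qed
        show ?thesis
          using *[OF contraction_semigroup_integral_in_generator[OF S, of h x], of "inverse h"] h
          by (metis add_0 fst_conv image_eqI less_imp_le)
      qed
      then show ?thesis using closure_subset
        by (auto simp: eventually_at_right_field intro!: exI[of _ 1])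
    qed
    ultimately have "S 0 x \<in> closure (fst ` generator S)"
      by (intro Lim_in_closed_set[OF closed_closure _ trivial_limit_at_right_real])
    then show ?thesis by (simp add: D(3))
  qed
  then show ?thesis by auto
qed

section \<open>The extrapolation space\<close>

locale extrapolated_semigroup =
  fixes S :: "real \<Rightarrow> 'a::chilbert_space \<Rightarrow> 'a"
    and \<mu> :: complex
    and j :: "'a \<Rightarrow> 'b::chilbert_space"
    and A1 :: "'a \<Rightarrow> 'b"
    and S1 :: "real \<Rightarrow> 'b \<Rightarrow> 'b"
  assumes S: "contraction_semigroup S"
    and \<mu>: "\<mu> \<in> resolvent_set (generator S)"
    and j: "extrapolation_space (generator S) \<mu> j"
    and A1: "extends_operator j (generator S) A1"
    and S1: "extends_semigroup j S S1"
begin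

abbreviation "R \<equiv> resolvent (generator S) \<mu>"

lemmas S_C0 = contraction_semigroupD(1)[OF S]
lemmas S_contr = contraction_semigroupD(2)[OF S]
lemmas S_lin = C0_semigroupD(2)[OF S_C0]
lemmas S_0 = C0_semigroupD(3)[OF S_C0]
lemmas S_add = C0_semigroupD(4)[OF S_C0]

lemma resolvent_unique:
  assumes "(x, y) \<in> generator S" "\<mu> *\<^sub>C x - y = z"
  shows "R z = x"
  unfolding resolvent_def
proof (rule the1_equality)
  show "\<exists>!x. \<exists>y. (x, y) \<in> generator S \<and> \<mu> *\<^sub>C x - y = z"
    using \<mu> unfolding resolvent_set_def by simp
qed (use assms in blast)

lemma resolvent_in_generator: "(R z, \<mu> *\<^sub>C R z - z) \<in> generator S"
proof -
  have "\<exists>!x. \<exists>y. (x, y) \<in> generator S \<and> \<mu> *\<^sub>C x - y = z"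
    using \<mu> unfolding resolvent_set_def by simp
  then obtain x y where xy: "(x, y) \<in> generator S" "\<mu> *\<^sub>C x - y = z" by blast
  then have "y = \<mu> *\<^sub>C x - z" by (simp add: algebra_simps)
  with xy resolvent_unique[OF xy] show ?thesis by simp
qed

lemma j_clin: "bounded_clinear j"
proof -
  have R: "bounded_linear R" using \<mu> unfolding resolvent_set_def bounded_clinear_def by simp
  have "clinear j" and n: "\<And>x. norm (j x) = norm (R x)"
    using j unfolding extrapolation_space_def by auto
  then have lin: "linear j" and c: "\<And>c x. j (c *\<^sub>C x) = c *\<^sub>C j x" by (auto simp: clinear_def)
  from bounded_linear.bounded[OF R] obtain K where "\<And>x. norm (R x) \<le> norm x * K" by blast
  with lin have "bounded_linear j"
    by (auto simp: bounded_linear_def bounded_linear_axioms_def n intro!: exI[of _ K])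
  with c show ?thesis by (simp add: bounded_clinear_def)
qed

lemmas j_lin = bounded_clinearD(1)[OF j_clin]
lemmas j_scaleC = bounded_clinearD(2)[OF j_clin]
lemma A1_lin: "bounded_linear A1" using A1 by (simp add: extends_operator_def bounded_clinear_def)
lemma A1_eq: "(x, y) \<in> generator S \<Longrightarrow> A1 x = j y" using A1 by (auto simp: extends_operator_def)
lemma S1_clin: "t \<ge> 0 \<Longrightarrow> bounded_clinear (S1 t)" using S1 by (simp add: extends_semigroup_def)
lemma S1_j: "t \<ge> 0 \<Longrightarrow> S1 t (j x) = j (S t x)" using S1 by (simp add: extends_semigroup_def)

lemma norm_j: "norm (j x) = norm (R x)"
  using j by (simp add: extrapolation_space_def)

lemma inj_j: "inj j"
proof -
  interpret j: bounded_linear j by (rule j_lin)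
  have "x = 0" if "j x = 0" for x
  proof -
    have "R x = 0" using norm_j[of x] that by simp
    then have "(0, - x) \<in> generator S"
      using resolvent_in_generator[of x]
        linear_0[OF bounded_linear.linear[OF bounded_linear_scaleC[of \<mu>, where 'a = 'a]]] by simp
    then have "((\<lambda>t. (S t 0 - 0) /\<^sub>R t) \<longlongrightarrow> - x) (at_right 0)" by (simp add: generator_def)
    moreover have "((\<lambda>t. (S t 0 - 0) /\<^sub>R t) \<longlongrightarrow> 0) (at_right 0)"
      by (rule Lim_transform_eventually[OF tendsto_const])
        (auto simp: eventually_at_right_field linear_0[OF bounded_linear.linear[OF S_lin]] intro!: exI[of _ 1])
    ultimately have "- x = 0" by (rule tendsto_unique[OF trivial_limit_at_right_real])
    then show ?thesis by simp
  qed
  then show ?thesis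
    by (simp add: linear_injective_0[OF bounded_linear.linear[OF j_lin]])
qed

text \<open>
  Operators built from bounded extensions are compared on the domain of the generator only.
\<close>
lemma dense_domain_eqI:
  fixes f g :: "'a \<Rightarrow> 'c::t2_space"
  assumes "continuous_on UNIV f" "continuous_on UNIV g" "\<And>x y. (x, y) \<in> generator S \<Longrightarrow> f x = g x"
  shows "f x = g x"
proof -
  have "closed {x. f x = g x}" using assms by (intro closed_Collect_eq)
  moreover have "fst ` generator S \<subseteq> {x. f x = g x}" using assms by auto
  ultimately have "closure (fst ` generator S) \<subseteq> {x. f x = g x}" by (rule closure_minimal[rotated])
  then show ?thesis using contraction_semigroup_generator_dense[OF S] by auto
qed

text \<open>
  The extension of \<open>\<mu> - A\<close> to a map from \<open>X\<close> into \<open>X\<^sub>-\<^sub>1\<close>.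
\<close>
definition Q :: "'a \<Rightarrow> 'b" where "Q x = \<mu> *\<^sub>C j x - A1 x"

lemma Q_lin: "bounded_linear Q"
  unfolding Q_def by (intro bounded_linear_sub A1_lin bounded_linear_compose[OF bounded_linear_scaleC j_lin])

lemma Q_generator: "(x, y) \<in> generator S \<Longrightarrow> Q x = j (\<mu> *\<^sub>C x - y)"
  by (simp add: Q_def A1_eq j_scaleC linear_diff[OF bounded_linear.linear[OF j_lin]])

lemma Q_resolvent: "Q (R x) = j x"
  using Q_generator[OF resolvent_in_generator] by simp

text \<open>
  On the domain of \<open>A\<close> this is the definition of the norm of \<open>X\<^sub>-\<^sub>1\<close>: \<open>Q x = j z\<close> with
  \<open>R z = x\<close>.
\<close>
lemma norm_Q: "norm (Q x) = norm x"
proof (rule dense_domain_eqI[where f = "\<lambda>x. norm (Q x)" and g = norm])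
  fix x y assume xy: "(x, y) \<in> generator S"
  then show "norm (Q x) = norm x"
    using Q_generator[OF xy] norm_j[of "\<mu> *\<^sub>C x - y"] resolvent_unique[OF xy refl] by simp
qed (intro continuous_intros bounded_linear.continuous_on[OF Q_lin])+

text \<open>
  The range of an isometry on a complete space is closed, and the range of \<open>Q\<close> contains the dense
  range of \<open>j\<close>, because \<open>Q R = j\<close>.
\<close>
lemma bij_Q: "bij Q"
proof -
  interpret Q: bounded_linear Q by (rule Q_lin)
  have "inj Q" using norm_Q by (simp add: linear_injective_0[OF Q.linear]) (metis norm_eq_zero)
  moreover have "complete (Q ` UNIV)"
    by (rule complete_isometric_image[of 1]) (auto simp: norm_Q Q_lin complete_UNIV)
  then have "closed (range Q)" by (rule complete_imp_closed)
  moreover have "range j \<subseteq> range Q" using Q_resolvent by (metis image_subsetI rangeI)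
  ultimately have "closure (range j) \<subseteq> range Q" by (intro closure_minimal)
  then have "surj Q" using j by (auto simp: extrapolation_space_def)
  with \<open>inj Q\<close> show ?thesis by (simp add: bij_def)
qed

lemma generator_invariant:
  assumes "(x, y) \<in> generator S" "t \<ge> 0"
  shows "(S t x, S t y) \<in> generator S"
proof -
  interpret bounded_linear "S t" using assms(2) by (rule S_lin)
  have "((\<lambda>h. S t ((S h x - x) /\<^sub>R h)) \<longlongrightarrow> S t y) (at_right 0)"
    using assms(1) by (intro tendsto) (simp add: generator_def)
  moreover have "\<forall>\<^sub>F h in at_right 0. S t ((S h x - x) /\<^sub>R h) = (S h (S t x) - S t x) /\<^sub>R h"
    using assms(2) S_add[of t _ x] S_add[of _ t x]
    by (auto simp: eventually_at_right_field scaleR diff add.commute intro!: exI[of _ 1])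
  ultimately have "((\<lambda>h. (S h (S t x) - S t x) /\<^sub>R h) \<longlongrightarrow> S t y) (at_right 0)"
    by (rule Lim_transform_eventually)
  then show ?thesis by (simp add: generator_def)
qed

lemma Q_S:
  assumes t: "t \<ge> 0"
  shows "Q (S t x) = S1 t (Q x)"
proof (rule dense_domain_eqI[where f = "\<lambda>x. Q (S t x)" and g = "\<lambda>x. S1 t (Q x)"])
  show "continuous_on UNIV (\<lambda>x. Q (S t x))"
    by (intro linear_continuous_on bounded_linear_compose[OF Q_lin] S_lin t)
  show "continuous_on UNIV (\<lambda>x. S1 t (Q x))"
    by (intro linear_continuous_on bounded_linear_compose[OF _ Q_lin] bounded_clinearD(1) S1_clin t)
  fix x y assume xy: "(x, y) \<in> generator S"
  have "Q (S t x) = j (S t (\<mu> *\<^sub>C x - y))"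
    using Q_generator[OF generator_invariant[OF xy t]] t
    by (simp add: linear_diff[OF bounded_linear.linear[OF S_lin]] bounded_clinearD(2)[OF C0_semigroupD(1)[OF S_C0]])
  then show "Q (S t x) = S1 t (Q x)"
    using Q_generator[OF xy] S1_j[OF t] by simp
qed

lemma A1_S:
  assumes t: "t \<ge> 0"
  shows "A1 (S t x) = S1 t (A1 x)"
proof -
  interpret S1: bounded_linear "S1 t" using bounded_clinearD(1)[OF S1_clin[OF t]] .
  have A: "A1 y = \<mu> *\<^sub>C j y - Q y" for y by (simp add: Q_def)
  have "A1 (S t x) = \<mu> *\<^sub>C S1 t (j x) - S1 t (Q x)"
    by (simp only: A Q_S[OF t] S1_j[OF t])
  also have "\<dots> = S1 t (\<mu> *\<^sub>C j x - Q x)"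
    by (simp only: S1.diff bounded_clinearD(2)[OF S1_clin[OF t]])
  finally show ?thesis by (simp only: A)
qed

text \<open>
  All the properties of \<open>S\<close> are carried over to \<open>S1\<close> by the isometry \<open>Q\<close>, since \<open>S1(t) Q = Q S(t)\<close>.
\<close>
lemma S1_contraction: "contraction_semigroup S1"
  unfolding contraction_semigroup_def C0_semigroup_def
proof (intro conjI allI impI)
  have surj: "\<exists>x. w = Q x" for w using bij_Q by (metis bij_pointE)
  fix s t :: real and w
  show "t \<ge> 0 \<Longrightarrow> bounded_clinear (S1 t)" by (rule S1_clin)
  obtain x where w: "w = Q x" using surj by blast
  show "S1 0 w = w" by (simp add: w flip: Q_S) (simp add: S_0)
  show "s \<ge> 0 \<Longrightarrow> t \<ge> 0 \<Longrightarrow> S1 (s + t) w = S1 s (S1 t w)"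
    by (simp add: w S_add flip: Q_S)
  show "t \<ge> 0 \<Longrightarrow> norm (S1 t w) \<le> norm w"
    by (simp add: w norm_Q S_contr flip: Q_S)
  have "((\<lambda>t. Q (S t x)) \<longlongrightarrow> w) (at_right 0)"
    unfolding w by (intro bounded_linear.tendsto[OF Q_lin] C0_semigroupD(5)[OF S_C0])
  then show "((\<lambda>t. S1 t w) \<longlongrightarrow> w) (at_right 0)"
    by (rule Lim_transform_eventually) (auto simp: w Q_S eventually_at_right_field intro!: exI[of _ 1])
qed

lemmas S1_lin = bounded_clinearD(1)[OF S1_clin]
lemmas S1_contr = contraction_semigroupD(2)[OF S1_contraction]
lemmas S1_add = C0_semigroupD(4)[OF contraction_semigroupD(1)[OF S1_contraction]]
lemmas S1_0 = C0_semigroupD(3)[OF contraction_semigroupD(1)[OF S1_contraction]]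

lemma S1_compose_continuous_on:
  assumes "bounded_linear B" "continuous_on X f" "\<And>z. z \<in> X \<Longrightarrow> 0 \<le> f z" "continuous_on X g"
  shows "continuous_on X (\<lambda>z. S1 (f z) (B (g z)))"
  by (intro contraction_semigroup_continuous_on[OF S1_contraction] assms
      bounded_linear.continuous_on[OF assms(1)])

text \<open>
  Every \<open>x \<in> X\<close> lies in the domain of the generator of \<open>S1\<close>, with image \<open>A1 x\<close>. The identity holds
  because \<open>A1\<close> is bounded and extends \<open>A\<close>, so it may be interchanged with the integral of \<open>S(s)x\<close>.
\<close>
lemma S1_orbit:
  assumes t: "t \<ge> 0"
  shows "j (S t x) - j x = integral {0..t} (\<lambda>s. S1 s (A1 x))"
proof -
  have "j (S t x) - j x = A1 (integral {0..t} (\<lambda>s. S s x))"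
    using A1_eq[OF contraction_semigroup_integral_in_generator[OF S t]]
    by (simp add: linear_diff[OF bounded_linear.linear[OF j_lin]])
  also have "\<dots> = integral {0..t} (A1 \<circ> (\<lambda>s. S s x))"
    by (intro integral_linear[symmetric] A1_lin integrable_continuous_real
      continuous_on_subset[OF contraction_semigroup_continuous[OF S]]) auto
  also have "\<dots> = integral {0..t} (\<lambda>s. S1 s (A1 x))"
    by (intro integral_cong) (simp add: A1_S)
  finally show ?thesis .
qed

text \<open>
  Bounded operators from \<open>X\<^sub>-\<^sub>1\<close> to \<open>X\<close> that converge to the inverse of \<open>j\<close> on its range. As
  \<open>Q\<inverse> j = R\<close> and \<open>x = (\<mu> - A) R x\<close>, they are obtained by replacing \<open>A\<close> in
  \<open>(\<mu> - A) Q\<inverse>\<close> by a difference quotient of \<open>S\<close>.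
\<close>
definition approx_inv :: "nat \<Rightarrow> 'b \<Rightarrow> 'a"
  where "approx_inv n w = \<mu> *\<^sub>C inv Q w - real (Suc n) *\<^sub>R (S (1 / real (Suc n)) (inv Q w) - inv Q w)"

lemma approx_inv_lin: "bounded_linear (approx_inv n)"
proof -
  have l: "bounded_linear (inv Q)"
  proof
    interpret Q: bounded_linear Q by (rule Q_lin)
    have Qi: "Q (inv Q w) = w" for w using bij_Q by (simp add: bij_is_surj surj_f_inv_f)
    have iQ: "inv Q (Q x) = x" for x using bij_Q by (simp add: bij_is_inj inv_f_f)
    fix v w :: 'b and r :: real
    show "inv Q (v + w) = inv Q v + inv Q w"
      using iQ[of "inv Q v + inv Q w"] by (simp only: Q.add Qi)
    show "inv Q (r *\<^sub>R v) = r *\<^sub>R inv Q v"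
      using iQ[of "r *\<^sub>R inv Q v"] by (simp only: Q.scaleR Qi)
    have "norm (inv Q w) \<le> norm w * 1" for w using norm_Q[of "inv Q w"] by (simp add: Qi)
    then show "\<exists>K. \<forall>w. norm (inv Q w) \<le> norm w * K" by blast
  qed
  show ?thesis unfolding approx_inv_def
    by (intro bounded_linear_sub bounded_linear_compose[OF bounded_linear_scaleC]
      bounded_linear_compose[OF bounded_linear_scaleR_right] bounded_linear_compose[OF S_lin] l) auto
qed

lemma approx_inv_tendsto: "(\<lambda>n. approx_inv n (j x)) \<longlonglongrightarrow> x"
proof -
  have Q: "inv Q (j x) = R x" using inv_f_f[OF bij_is_inj[OF bij_Q], of "R x"] by (simp only: Q_resolvent)
  have "((\<lambda>t. (S t (R x) - R x) /\<^sub>R t) \<longlongrightarrow> \<mu> *\<^sub>C R x - x) (at_right 0)"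
    using resolvent_in_generator[of x] by (simp add: generator_def)
  moreover have "filterlim (\<lambda>n. 1 / real (Suc n)) (at_right 0) sequentially"
    unfolding filterlim_at using LIMSEQ_inverse_real_of_nat by (auto simp: inverse_eq_divide)
  ultimately have "(\<lambda>n. (S (1 / real (Suc n)) (R x) - R x) /\<^sub>R (1 / real (Suc n))) \<longlonglongrightarrow> \<mu> *\<^sub>C R x - x"
    by (rule filterlim_compose)
  then have "(\<lambda>n. \<mu> *\<^sub>C R x - (S (1 / real (Suc n)) (R x) - R x) /\<^sub>R (1 / real (Suc n))) \<longlonglongrightarrow> \<mu> *\<^sub>C R x - (\<mu> *\<^sub>C R x - x)"
    by (intro tendsto_intros)
  then show ?thesis by (simp add: approx_inv_def Q)
qed

end

section \<open>Uniform boundedness and weakly singular inputs\<close>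

text \<open>
  The Banach--Steinhaus theorem, from the Baire category theorem: one of the closed sets on which
  the family is bounded by a given integer contains a ball.
\<close>
lemma uniform_boundedness:
  fixes f :: "nat \<Rightarrow> 'e::{real_normed_vector, complete_space} \<Rightarrow> 'c::real_normed_vector"
  assumes lin: "\<And>n. bounded_linear (f n)" and pt: "\<And>x. \<exists>K. \<forall>n. norm (f n x) \<le> K"
  obtains C where "C > 0" "\<And>n x. norm (f n x) \<le> C * norm x"
proof -
  define F where "F m = {x. \<forall>n. norm (f n x) \<le> real m}" for m
  have closed: "closed (F m)" for m
    unfolding F_def
    by (intro closed_Collect_all closed_Collect_le continuous_intros linear_continuous_on lin)
  have cover: "\<Union> (range F) = UNIV"
  proof -
    have "\<exists>m. x \<in> F m" for x
    proof -
      obtain K where K: "\<And>n. norm (f n x) \<le> K" using pt by blast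
      obtain m :: nat where "K \<le> real m" using real_arch_simple by blast
      with K have "norm (f n x) \<le> real m" for n by (meson order_trans)
      then show ?thesis unfolding F_def by blast
    qed
    then show ?thesis by blast
  qed
  have "\<exists>m. interior (F m) \<noteq> {}"
  proof (rule ccontr)
    assume "\<nexists>m. interior (F m) \<noteq> {}"
    then have "euclidean interior_of \<Union> (range F) = {}"
      using closed
      by (intro Baire_category_alt) (auto simp: completely_metrizable_space_euclidean)
    then show False by (simp add: cover)
  qed
  then obtain m x0 where "x0 \<in> interior (F m)" by blast
  then obtain r where r: "r > 0" "ball x0 r \<subseteq> F m"
    using mem_interior by blast
  have x0: "norm (f n x0) \<le> m" for n
    using r by (auto simp: F_def subset_iff)
  show ?thesis
  proof (rule that[of "4 * (real m + 1) / r"])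
    show "4 * (real m + 1) / r > 0" using r by simp
    fix n x
    interpret bounded_linear "f n" by (rule lin)
    show "norm (f n x) \<le> 4 * (real m + 1) / r * norm x"
    proof (cases "x = 0")
      case False
      define c where "c = r / (2 * norm x)"
      have c: "c > 0" using r False by (simp add: c_def)
      have "x0 + c *\<^sub>R x \<in> ball x0 r" using r False by (simp add: dist_norm c_def)
      then have "norm (f n (x0 + c *\<^sub>R x)) \<le> m" using r(2) by (auto simp: F_def)
      moreover have "c *\<^sub>R f n x = f n (x0 + c *\<^sub>R x) - f n x0" by (simp add: add scaleR)
      ultimately have "norm (c *\<^sub>R f n x) \<le> m + m"
        using x0[of n] norm_triangle_ineq4[of "f n (x0 + c *\<^sub>R x)" "f n x0"] by simp
      then have "c * norm (f n x) \<le> 2 * (real m + 1)" using c by simp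
      then show ?thesis using r False by (simp add: c_def field_simps)
    qed (simp add: zero)
  qed
qed

text \<open>
  The substitution \<open>r = (T - s)\<^sup>q / q\<close> with \<open>q = 1 - a\<close> absorbs the weight and leaves a continuous
  integrand. It is carried out through an explicit antiderivative.
\<close>
lemma singular_weight_integrable:
  fixes F :: "real \<Rightarrow> 'b::banach"
  assumes T: "T > 0" and a: "0 \<le> a" "a < 1" and F: "continuous_on {0..T} F"
  shows "(\<lambda>s. (T - s) powr (- a) *\<^sub>R F s) integrable_on {0..T}"
proof -
  define q where "q = 1 - a"
  define L where "L = T powr q / q"
  define \<phi> where "\<phi> s = (T - s) powr q / q" for s
  define G where "G r = F (T - (q * r) powr (1 / q))" for r
  define K where "K r = integral {0..r} G" for r
  have q: "0 < q" "q \<le> 1" using a by (auto simp: q_def)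
  have inv_phi: "(q * \<phi> s) powr (1 / q) = T - s" if "s \<le> T" for s
    using that q by (simp add: \<phi>_def powr_powr)
  have L: "(q * r) powr (1 / q) \<le> T" if "0 \<le> r" "r \<le> L" for r
  proof -
    have "(q * r) powr (1/q) \<le> (T powr q) powr (1/q)"
      using that q by (intro powr_mono2) (auto simp: L_def field_simps)
    then show ?thesis using T q by (simp add: powr_powr)
  qed
  have G: "continuous_on {0..L} G"
    unfolding G_def
    by (rule continuous_on_compose2[OF F]) (use q L in \<open>auto intro!: continuous_intros continuous_on_powr'\<close>)
  have K: "continuous_on {0..L} K"
    unfolding K_def by (intro indefinite_integral_continuous_1 integrable_continuous_real G)
  have \<phi>: "continuous_on {0..T} \<phi>"
    unfolding \<phi>_def using q by (auto intro!: continuous_intros continuous_on_powr')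
  have \<phi>_L: "\<phi> s \<in> {0..L}" if "s \<in> {0..T}" for s
    using that q T unfolding \<phi>_def L_def by (auto intro!: divide_right_mono powr_mono2)
  have "((\<lambda>s. (T - s) powr (- a) *\<^sub>R F s) has_integral - K (\<phi> T) - - K (\<phi> 0)) {0..T}"
  proof (rule fundamental_theorem_of_calculus_interior)
    show "continuous_on {0..T} (\<lambda>s. - K (\<phi> s))"
      by (intro continuous_intros continuous_on_compose2[OF K \<phi>]) (use \<phi>_L in auto)
    fix s assume s: "s \<in> {0<..<T}"
    have in_L: "0 < \<phi> s" "\<phi> s < L"
      using s q T unfolding \<phi>_def L_def by (auto intro!: divide_strict_right_mono powr_less_mono2)
    have "(K has_vector_derivative G (\<phi> s)) (at (\<phi> s) within {0..L})"
      unfolding K_def using in_L by (intro integral_has_vector_derivative G) auto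
    then have dK: "(K has_vector_derivative G (\<phi> s)) (at (\<phi> s))"
      using in_L by (simp add: at_within_Icc_at)
    have d\<phi>: "(\<phi> has_real_derivative - ((T - s) powr (- a))) (at s)"
      unfolding \<phi>_def using s q
      by (auto intro!: derivative_eq_intros simp: q_def)
    have "(K \<circ> \<phi> has_vector_derivative (- ((T - s) powr (- a))) *\<^sub>R G (\<phi> s)) (at s)"
      by (rule vector_diff_chain_at[where f = \<phi> and g = K, OF _ dK]) (use d\<phi> in \<open>simp add: has_real_derivative_iff_has_vector_derivative\<close>)
    then have "((\<lambda>s. K (\<phi> s)) has_vector_derivative (- ((T - s) powr (- a))) *\<^sub>R G (\<phi> s)) (at s)"
      by (simp add: o_def)
    moreover have "G (\<phi> s) = F s" using s by (simp add: G_def inv_phi)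
    ultimately show "((\<lambda>s. - K (\<phi> s)) has_vector_derivative (T - s) powr (- a) *\<^sub>R F s) (at s)"
      by (auto intro!: derivative_eq_intros)
  qed (use T in simp)
  then show ?thesis by blast
qed

text \<open>
  Sampling \<open>u\<close> at the points \<open>\<lfloor>n t\<rfloor> / n\<close> gives simple functions that converge at every point
  of continuity, without any separability of the range.
\<close>
lemma strongly_measurable_piecewise_continuous:
  fixes u :: "real \<Rightarrow> 'a::real_normed_vector"
  assumes N: "finite N" and u: "continuous_on ({0<..<T} - N) u"
  shows "strongly_measurable (lebesgue_on {0..T}) u"
  unfolding strongly_measurable_def
proof (intro exI conjI allI)
  let ?M = "lebesgue_on {0..T}"
  define fl where "fl n t = \<lfloor>real n * t\<rfloor>" for n t
  show "simple_function ?M (\<lambda>t. u (real_of_int (fl n t) / real n))" for n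
  proof (rule simple_function_compose1[where g = "\<lambda>k. u (real_of_int k / real n)"])
    have "fl n ` {0..T} \<subseteq> {0..\<lfloor>real n * T\<rfloor>}"
      by (auto simp: fl_def intro!: floor_mono mult_left_mono)
    then have "finite (fl n ` space ?M)" by (auto intro: finite_subset)
    moreover have "fl n \<in> measurable ?M (count_space UNIV)"
    proof -
      have "fl n \<in> measurable borel (count_space UNIV)" unfolding fl_def by measurable
      then have "fl n \<in> measurable lebesgue (count_space UNIV)"
        by (simp add: measurable_completion)
      then show ?thesis by (rule measurable_restrict_space1)
    qed
    ultimately show "simple_function ?M (fl n)" by (simp add: simple_function_eq_measurable)
  qed
  have lim: "(\<lambda>n. u (real_of_int (fl n t) / real n)) \<longlonglongrightarrow> u t" if t: "t \<in> {0<..<T} - N" for t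
  proof -
    have "open ({0<..<T} - N)" using N by (intro open_Diff finite_imp_closed) auto
    then have "isCont u t" using u t by (simp add: continuous_on_eq_continuous_at)
    moreover have "(\<lambda>n. real_of_int (fl n t) / real n) \<longlonglongrightarrow> t"
    proof (rule tendsto_sandwich[where f = "\<lambda>n. t - inverse (real n)" and h = "\<lambda>_. t"])
      show "(\<lambda>n. t - inverse (real n)) \<longlonglongrightarrow> t"
        using tendsto_diff[OF tendsto_const lim_inverse_n, of t] by simp
      show "\<forall>\<^sub>F n in sequentially. t - inverse (real n) \<le> real_of_int (fl n t) / real n"
        using eventually_gt_at_top[of 0]
      proof eventually_elim
        case (elim n)
        have "real n * t - 1 \<le> real_of_int (fl n t)" unfolding fl_def by linarith
        then have "(real n * t - 1) / real n \<le> real_of_int (fl n t) / real n"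
          by (rule divide_right_mono) simp
        then show ?case using elim by (simp add: diff_divide_distrib inverse_eq_divide)
      qed
      show "\<forall>\<^sub>F n in sequentially. real_of_int (fl n t) / real n \<le> t"
        using eventually_gt_at_top[of 0]
      proof eventually_elim
        case (elim n)
        have "real_of_int (fl n t) \<le> real n * t" unfolding fl_def by linarith
        then show ?case using elim by (simp add: field_simps)
      qed
    qed simp
    ultimately show ?thesis by (rule isCont_tendsto_compose)
  qed
  have "N \<union> {0, T} \<in> null_sets lebesgue"
    using N by (simp add: negligible_iff_null_sets[symmetric] negligible_finite)
  then have "AE t in lebesgue. t \<notin> N \<union> {0, T}" by (rule AE_not_in)
  then have "AE t in lebesgue. t \<in> {0..T} \<longrightarrow> (\<lambda>n. u (real_of_int (fl n t) / real n)) \<longlonglongrightarrow> u t"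
    by (rule eventually_mono) (auto intro!: lim)
  then show "AE t in ?M. (\<lambda>n. u (real_of_int (fl n t) / real n)) \<longlonglongrightarrow> u t"
    by (simp add: AE_restrict_space_iff)
qed

text \<open>
  These are the inputs to which admissibility is applied. With \<open>c = 0\<close> they form a Banach space of
  inputs with a prescribed blow-up at \<open>T\<close>; with \<open>c > 0\<close> they realise integrals over \<open>[0, T - c]\<close>
  as inputs on \<open>[0, T]\<close>.
\<close>
lemma singular_weight_Lp:
  fixes f :: "real \<Rightarrow> 'a::banach"
  assumes T: "T > 0" and p: "p \<ge> 1" and a: "0 \<le> a" "a * p < 1" and c: "0 \<le> c" "c \<le> T"
    and f: "continuous_on {0..T} f"
  shows "(\<lambda>s. if s < c then 0 else (T - s) powr (- a) *\<^sub>R f s) \<in> Lp_fun p T"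
  unfolding Lp_fun_def
proof (intro CollectI conjI)
  let ?u = "\<lambda>s. if s < c then 0 else (T - s) powr (- a) *\<^sub>R f s"
  show "strongly_measurable (lebesgue_on {0..T}) ?u"
  proof (rule strongly_measurable_piecewise_continuous[of "{c}"])
    have "continuous_on ({0<..<c} \<union> {c<..<T}) ?u"
    proof (rule continuous_on_open_Un)
      show "continuous_on {0<..<c} ?u"
        by (rule continuous_on_eq[of _ "\<lambda>_. 0"]) auto
      have "continuous_on {c<..<T} (\<lambda>s. (T - s) powr (- a) *\<^sub>R f s)"
        using c by (intro continuous_intros continuous_on_subset[OF f]) auto
      then show "continuous_on {c<..<T} ?u"
        by (rule continuous_on_eq) auto
    qed auto
    then show "continuous_on ({0<..<T} - {c}) ?u"
      by (rule continuous_on_subset) auto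
  qed simp
  define h where "h s = (T - s) powr (- (a * p)) *\<^sub>R norm (f s) powr p" for s
  have "h integrable_on {0..T}"
    unfolding h_def using p a
    by (intro singular_weight_integrable T continuous_on_powr' continuous_on_norm f continuous_on_const) auto
  then have "h integrable_on {c..T}" using c by (auto intro: integrable_on_subinterval)
  then have "(\<lambda>s. if s \<in> {c..T} then h s else 0) integrable_on {0..T}"
    using has_integral_restrict[of "{c..T}" "{0..T}" h] c by (auto simp: integrable_on_def)
  moreover have "(if s \<in> {c..T} then h s else 0) = norm (?u s) powr p" if "s \<in> {0..T}" for s
    using that p by (auto simp: h_def powr_mult powr_powr)
  ultimately have "(\<lambda>s. norm (?u s) powr p) integrable_on {0..T}"
    by (rule Henstock_Kurzweil_Integration.integrable_eq)
  then have "(\<lambda>s. norm (?u s) powr p) absolutely_integrable_on {0..T}"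
    by (rule nonnegative_absolutely_integrable_1) simp
  then show "integrable (lebesgue_on {0..T}) (\<lambda>s. norm (?u s) powr p)"
    by (simp add: integrable_restrict_space set_integrable_def)
qed

section \<open>The quantitative form of admissibility\<close>

locale admissible_perturbation = extrapolated_semigroup S \<mu> j A1 S1
  for S :: "real \<Rightarrow> 'a::chilbert_space \<Rightarrow> 'a" and \<mu> and j :: "'a \<Rightarrow> 'b::chilbert_space"
    and A1 S1 +
  fixes B :: "'a \<Rightarrow> 'b" and p T :: real
  assumes B: "bounded_clinear B" and p: "p > 1" and T: "T > 0"
    and admissible: "admissible j S1 B p T"
begin

lemmas B_lin = bounded_clinearD(1)[OF B]

lemmas S1_B_continuous_on = S1_compose_continuous_on[OF B_lin]

lemma norm_S1_B:
  obtains K where "K > 0" "\<And>t x. t \<ge> 0 \<Longrightarrow> norm (S1 t (B x)) \<le> K * norm x"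
proof -
  obtain K where K: "K > 0" "\<And>x. norm (B x) \<le> norm x * K"
    using bounded_linear.pos_bounded[OF B_lin] by blast
  show ?thesis
    by (rule that[of K]) (use K S1_contr in \<open>auto simp: mult.commute intro: order_trans\<close>)
qed

text \<open>
  Any positive exponent below \<open>1/p\<close> would do.
\<close>
definition weight :: real where "weight = 1 / (2 * p)"

lemma weight: "0 < weight" "weight < 1" "weight * p < 1"
  using p by (auto simp: weight_def field_simps)

text \<open>
  The input map on \<open>u(s) = (T - s)\<^sup>-\<^sup>a f(s)\<close>. Parametrising the inputs by bounded continuous
  functions \<open>f\<close> makes the domain a Banach space.
\<close>
definition weighted_input :: "(real \<Rightarrow>\<^sub>C 'a) \<Rightarrow> 'b"
  where "weighted_input f = integral {0..T} (\<lambda>s. (T - s) powr (- weight) *\<^sub>R S1 (T - s) (B (f s)))"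

lemma weighted_input_integrable:
  fixes f :: "real \<Rightarrow>\<^sub>C 'a"
  shows "(\<lambda>s. (T - s) powr (- weight) *\<^sub>R S1 (T - s) (B (f s))) integrable_on {0..T}"
  using weight by (intro singular_weight_integrable T S1_B_continuous_on) (auto intro!: continuous_intros)

lemma weighted_input_lin: "bounded_linear weighted_input"
proof -
  obtain K where K: "K > 0" "\<And>t x. t \<ge> 0 \<Longrightarrow> norm (S1 t (B x)) \<le> K * norm x"
    using norm_S1_B by blast
  let ?w = "\<lambda>s. (T - s) powr (- weight)"
  have w: "?w integrable_on {0..T}"
    using singular_weight_integrable[OF T _ weight(2), of "\<lambda>_. 1::real"] weight(1) by simp
  have lin: "bounded_linear (\<lambda>x. S1 t (B x))" if "t \<ge> 0" for t
    using bounded_linear_compose[OF S1_lin[OF that] B_lin] .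
  show ?thesis
  proof
    fix f g :: "real \<Rightarrow>\<^sub>C 'a" and r :: real
    have "weighted_input (f + g) = integral {0..T} (\<lambda>s. ?w s *\<^sub>R S1 (T - s) (B (f s)) + ?w s *\<^sub>R S1 (T - s) (B (g s)))"
      unfolding weighted_input_def
      by (intro integral_cong)
        (simp add: plus_bcontfun.rep_eq linear_add[OF bounded_linear.linear[OF lin]] scaleR_add_right)
    then show "weighted_input (f + g) = weighted_input f + weighted_input g"
      by (simp add: weighted_input_def integral_add weighted_input_integrable)
    have "weighted_input (r *\<^sub>R f) = integral {0..T} (\<lambda>s. r *\<^sub>R (?w s *\<^sub>R S1 (T - s) (B (f s))))"
      unfolding weighted_input_def
      by (intro integral_cong)
        (simp add: scaleR_bcontfun.rep_eq linear_scale[OF bounded_linear.linear[OF lin]])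
    then show "weighted_input (r *\<^sub>R f) = r *\<^sub>R weighted_input f"
      by (simp only: weighted_input_def integral_cmul)
    have "norm (weighted_input f) \<le> norm f * (integral {0..T} ?w * K)" for f
    proof -
      have "norm (weighted_input f) \<le> integral {0..T} (\<lambda>s. ?w s * (K * norm f))"
        unfolding weighted_input_def
      proof (rule integral_norm_bound_integral)
        fix s assume s: "s \<in> {0..T}"
        have "norm (S1 (T - s) (B (f s))) \<le> K * norm (f s)" using K(2) s by simp
        also have "\<dots> \<le> K * norm f" using K(1) norm_bounded by (simp add: mult_left_mono)
        finally show "norm (?w s *\<^sub>R S1 (T - s) (B (f s))) \<le> ?w s * (K * norm f)"
          by (simp add: mult_left_mono)
      qed (use w in \<open>auto intro!: weighted_input_integrable integrable_on_mult_left\<close>)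
      then show ?thesis by (simp add: mult_ac)
    qed
    then show "\<exists>K. \<forall>f. norm (weighted_input f) \<le> norm f * K" by blast
  qed
qed

lemma weighted_input_range: "weighted_input f \<in> range j"
proof -
  let ?u = "\<lambda>s. if s < 0 then 0 else (T - s) powr (- weight) *\<^sub>R apply_bcontfun f s"
  have "?u \<in> Lp_fun p T"
    using weight p T by (intro singular_weight_Lp) auto
  then have "integral {0..T} (\<lambda>s. S1 (T - s) (B (?u s))) \<in> range j"
    using bspec[OF admissible[unfolded admissible_def]] by simp
  also have "integral {0..T} (\<lambda>s. S1 (T - s) (B (?u s))) = weighted_input f"
    unfolding weighted_input_def
    by (intro integral_cong)
      (auto simp: linear_scale[OF bounded_linear.linear[OF bounded_linear_compose[OF S1_lin B_lin]]])
  finally show ?thesis .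
qed

text \<open>
  By admissibility the sequence \<open>approx_inv n (weighted_input f)\<close> converges for every \<open>f\<close>; so it is
  pointwise bounded, hence uniformly bounded.
\<close>
lemma weighted_input_bound:
  obtains C where "C > 0" "\<And>n f. norm (approx_inv n (weighted_input f)) \<le> C * norm f"
proof (rule uniform_boundedness[of "\<lambda>n f. approx_inv n (weighted_input f)"])
  show "bounded_linear (\<lambda>f. approx_inv n (weighted_input f))" for n
    using bounded_linear_compose[OF approx_inv_lin weighted_input_lin] .
  show "\<exists>K. \<forall>n. norm (approx_inv n (weighted_input f)) \<le> K" for f
  proof -
    obtain x where "weighted_input f = j x" using weighted_input_range by blast
    then have "convergent (\<lambda>n. approx_inv n (weighted_input f))"
      using approx_inv_tendsto by (auto simp: convergent_def)
    then show ?thesis by (meson convergent_imp_Bseq BseqE)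
  qed
qed (use that in blast)

text \<open>
  Membership in the range of \<open>j\<close> follows from admissibility for the input that vanishes before
  time \<open>T - t\<close>. That input equals \<open>(T - s)\<^sup>-\<^sup>a f(s)\<close> with \<open>norm (f s) \<le> t\<^sup>a M\<close>, which is the source
  of the factor \<open>t\<^sup>a\<close>, but \<open>f\<close> jumps at \<open>T - t\<close>. Continuous cut-offs approximate it with the
  same bound, and the bound passes to the limit because each \<open>approx_inv n\<close> is continuous on
  \<open>X\<^sub>-\<^sub>1\<close>.
\<close>
lemma input_integral_bound:
  obtains C where "C > 0" "\<And>g t M. 0 \<le> t \<Longrightarrow> t \<le> T \<Longrightarrow> continuous_on {0..t} g \<Longrightarrow>
      (\<And>r. r \<in> {0..t} \<Longrightarrow> norm (g r) \<le> M) \<Longrightarrow>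
      \<exists>y. j y = integral {0..t} (\<lambda>r. S1 r (B (g r))) \<and> norm y \<le> C * t powr weight * M"
proof -
  obtain C where C: "C > 0" "\<And>n f. norm (approx_inv n (weighted_input f)) \<le> C * norm f"
    using weighted_input_bound by blast
  obtain K where K: "K > 0" "\<And>t x. t \<ge> 0 \<Longrightarrow> norm (S1 t (B x)) \<le> K * norm x"
    using norm_S1_B by blast
  have "\<exists>y. j y = integral {0..t} (\<lambda>r. S1 r (B (g r))) \<and> norm y \<le> C * t powr weight * M"
    if t: "0 \<le> t" "t \<le> T" and g: "continuous_on {0..t} g" and M: "\<And>r. r \<in> {0..t} \<Longrightarrow> norm (g r) \<le> M"
    for g :: "real \<Rightarrow> 'a" and t M
  proof -
    define c where "c = T - t"
    define G where "G s = g (max 0 (min t (T - s)))" for s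
    define w where "w s = (max 0 (min t (T - s))) powr weight" for s
    define u where "u s = (if s < c then 0 else (T - s) powr (- weight) *\<^sub>R (w s *\<^sub>R G s))" for s
    have c: "0 \<le> c" "c \<le> T" using t by (auto simp: c_def)
    have G: "continuous_on X G" for X
      unfolding G_def using t by (intro continuous_on_compose2[OF g] continuous_intros) auto
    have G_M: "norm (G s) \<le> M" for s unfolding G_def using t by (intro M) auto
    have M0: "M \<ge> 0" using G_M[of 0] norm_ge_zero order_trans by blast
    have w: "continuous_on X w" for X
      unfolding w_def using weight by (intro continuous_on_powr' continuous_intros) auto
    have w_le: "0 \<le> w s" "w s \<le> t powr weight" for s
      unfolding w_def using weight t by (auto intro!: powr_mono2)
    have wG: "continuous_on X (\<lambda>s. w s *\<^sub>R G s)" for X by (intro continuous_intros w G)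
    have w_cancel: "(T - s) powr (- weight) * w s = 1" if "c \<le> s" "s < T" for s
    proof -
      have "w s = (T - s) powr weight" using that by (simp add: w_def c_def)
      then show ?thesis using that by (simp flip: powr_add)
    qed
    have w_cancel_le: "(T - s) powr (- weight) * w s \<le> 1" if "s \<le> T" for s
    proof (cases "s = T")
      case False
      have "w s \<le> (T - s) powr weight" unfolding w_def using that t weight by (intro powr_mono2) auto
      then have "(T - s) powr (- weight) * w s \<le> (T - s) powr (- weight) * (T - s) powr weight"
        by (intro mult_left_mono) auto
      also have "\<dots> = 1" using that False by (simp flip: powr_add)
      finally show ?thesis .
    qed simp
    let ?J = "integral {0..t} (\<lambda>r. S1 r (B (g r)))"
    have J: "((\<lambda>s. S1 (T - s) (B (u s))) has_integral ?J) {0..T}"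
    proof -
      have "((\<lambda>r. S1 r (B (g r))) has_integral ?J) {0..t}"
        by (intro integrable_integral integrable_continuous_real S1_B_continuous_on g continuous_intros) auto
      then have "((\<lambda>r. S1 (- r) (B (g (- r)))) has_integral ?J) {- t..- 0}"
        by (subst has_integral_reflect_real)
      then have "((\<lambda>r. S1 (- (r + - T)) (B (g (- (r + - T))))) has_integral ?J) {- t - - T..- 0 - - T}"
        by (rule has_integral_shift_real_ivl)
      then have "((\<lambda>s. S1 (T - s) (B (g (T - s)))) has_integral ?J) {c..T}" by (simp add: c_def)
      then have "((\<lambda>s. if s \<in> {c..T} then S1 (T - s) (B (g (T - s))) else 0) has_integral ?J) {0..T}"
        using c by (subst has_integral_restrict) auto
      then show ?thesis
      proof (rule has_integral_spike_finite[of "{T}", rotated 2])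
        fix s assume s: "s \<in> {0..T} - {T}"
        show "S1 (T - s) (B (u s)) = (if s \<in> {c..T} then S1 (T - s) (B (g (T - s))) else 0)"
        proof (cases "s < c")
          case True
          have "S1 (T - s) (B 0) = 0"
            using s linear_0[OF bounded_linear.linear[OF bounded_linear_compose[OF S1_lin B_lin]]] by simp
          then show ?thesis using True by (simp add: u_def)
        next
          case False
          then have "G s = g (T - s)" using s by (simp add: G_def c_def)
          then show ?thesis using False s w_cancel[of s] by (simp add: u_def)
        qed
      qed simp
    qed
    have "u \<in> Lp_fun p T"
      unfolding u_def using weight p T c by (intro singular_weight_Lp wG) auto
    then have "?J \<in> range j"
      using admissible integral_unique[OF J] unfolding admissible_def by metis
    then obtain y where y: "j y = ?J" by auto
    \<comment> \<open>Equal to 1 from \<open>c\<close> on, equal to 0 up to \<open>c - 1 / (k + 1)\<close>, affine in between.\<close>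
    define cut where "cut k s = max 0 (min 1 (1 - real (Suc k) * (c - s)))" for k s
    have cut: "0 \<le> cut k s" "cut k s \<le> 1" for k s by (auto simp: cut_def)
    have cut1: "cut k s = 1" if "s \<ge> c" for k s
      using that mult_nonneg_nonpos[of "real (Suc k)" "c - s"] by (auto simp: cut_def)
    have cut0: "cut k s = 0" if "s \<le> c - 1 / real (Suc k)" for k s
    proof -
      have "1 / real (Suc k) \<le> c - s" using that by simp
      then have "1 \<le> real (Suc k) * (c - s)" by (simp add: pos_divide_le_eq mult.commute)
      then show ?thesis by (simp add: cut_def)
    qed
    define f where "f k = Bcontfun (\<lambda>s. (cut k s * w s) *\<^sub>R G s)" for k
    have bound: "norm ((cut k s * w s) *\<^sub>R G s) \<le> t powr weight * M" for k s
    proof -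
      have "cut k s * w s \<le> 1 * t powr weight" using cut[of k s] w_le[of s] by (intro mult_mono) auto
      then show ?thesis using cut[of k s] w_le[of s] G_M[of s] by (auto intro!: mult_mono simp: abs_mult)
    qed
    have f: "apply_bcontfun (f k) s = (cut k s * w s) *\<^sub>R G s" for k s
    proof -
      have "(\<lambda>s. (cut k s * w s) *\<^sub>R G s) \<in> bcontfun"
        by (rule bcontfun_normI[OF _ bound]) (auto intro!: continuous_intros w G simp: cut_def[abs_def])
      then show ?thesis unfolding f_def by (subst Bcontfun_inverse) auto
    qed
    have norm_f: "norm (f k) \<le> t powr weight * M" for k
      by (rule norm_bound) (unfold f, rule bound)
    \<comment> \<open>The two integrands differ only on an interval of length at most \<open>1 / (k + 1)\<close>.\<close>
    have close: "norm (weighted_input (f k) - j y) \<le> K * M / real (Suc k)" for k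
    proof -
      define b where "b = max 0 (c - 1 / real (Suc k))"
      have b: "0 \<le> b" "b \<le> c" using c by (auto simp: b_def)
      let ?F = "\<lambda>s. (T - s) powr (- weight) *\<^sub>R S1 (T - s) (B (f k s))"
      have "weighted_input (f k) - j y = integral {0..T} (\<lambda>s. ?F s - S1 (T - s) (B (u s)))"
        using y J by (simp add: integral_diff weighted_input_integrable weighted_input_def has_integral_integrable integral_unique)
      also have "norm \<dots> \<le> integral {0..T} (\<lambda>s. if s \<in> {b..c} then K * M else 0)"
      proof (rule integral_norm_bound_integral)
        show "(\<lambda>s. ?F s - S1 (T - s) (B (u s))) integrable_on {0..T}"
          using weighted_input_integrable J by (intro integrable_diff) auto
        show "(\<lambda>s. if s \<in> {b..c} then K * M else 0) integrable_on {0..T}"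
          using b c has_integral_restrict[of "{b..c}" "{0..T}" "\<lambda>_. K * M"] has_integral_const_real[of "K * M" b c]
          by (meson atLeastatMost_subset_iff has_integral_integrable)
        fix s assume s: "s \<in> {0..T}"
        have scale: "r *\<^sub>R S1 (T - s) (B x) = S1 (T - s) (B (r *\<^sub>R x))" for r x
          using s linear_scale[OF bounded_linear.linear[OF bounded_linear_compose[OF S1_lin B_lin]]] by simp
        have zero: "S1 (T - s) (B 0) = 0"
          using s linear_0[OF bounded_linear.linear[OF bounded_linear_compose[OF S1_lin B_lin]]] by simp
        consider "s \<ge> c" | "s < b" | "s \<in> {b..c}" "s < c" using b by fastforce
        then show "norm (?F s - S1 (T - s) (B (u s))) \<le> (if s \<in> {b..c} then K * M else 0)"
        proof cases
          case 1
          then show ?thesis using K(1) M0 by (simp add: f cut1 u_def scale)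
        next
          case 2
          then have "cut k s = 0" using cut0[of s k] s by (auto simp: b_def)
          then show ?thesis using 2 b by (simp add: f u_def scale zero)
        next
          case 3
          have "?F s - S1 (T - s) (B (u s)) = S1 (T - s) (B (((T - s) powr (- weight) * (cut k s * w s)) *\<^sub>R G s))"
            using 3 by (simp add: f u_def scale zero)
          also have "norm \<dots> \<le> K * norm (((T - s) powr (- weight) * (cut k s * w s)) *\<^sub>R G s)"
            using s by (intro K(2)) auto
          also have "\<dots> \<le> K * (1 * M)"
          proof -
            let ?c = "(T - s) powr (- weight) * (cut k s * w s)"
            have "?c = cut k s * ((T - s) powr (- weight) * w s)" by simp
            also have "\<dots> \<le> 1 * 1"
              using cut[of k s] w_cancel_le[of s] s by (intro mult_mono) (auto simp: w_le)
            finally have "?c \<le> 1" by simp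
            moreover have "0 \<le> ?c" using cut(1) w_le(1) by simp
            ultimately have "norm (?c *\<^sub>R G s) \<le> 1 * M"
              unfolding norm_scaleR using G_M[of s] by (intro mult_mono) auto
            then show ?thesis using K(1) by (intro mult_left_mono) auto
          qed
          finally show ?thesis using 3 by simp
        qed
      qed
      also have "integral {0..T} (\<lambda>s. if s \<in> {b..c} then K * M else 0) = K * M * (c - b)"
        using b c has_integral_restrict[of "{b..c}" "{0..T}" "\<lambda>_. K * M"] has_integral_const_real[of "K * M" b c]
        by (intro integral_unique) (auto simp: mult.commute)
      also have "\<dots> \<le> K * M * (1 / real (Suc k))"
        using K(1) M0 by (intro mult_left_mono) (auto simp: b_def)
      finally show ?thesis by simp
    qed
    have "(\<lambda>k. weighted_input (f k) - j y) \<longlonglongrightarrow> 0"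
    proof (rule Lim_null_comparison)
      show "\<forall>\<^sub>F k in sequentially. norm (weighted_input (f k) - j y) \<le> K * M * inverse (real (Suc k))"
        using close by (simp add: divide_inverse)
      show "(\<lambda>k. K * M * inverse (real (Suc k))) \<longlonglongrightarrow> 0"
        using tendsto_mult[OF tendsto_const LIMSEQ_inverse_real_of_nat] by simp
    qed
    then have lim: "(\<lambda>k. weighted_input (f k)) \<longlonglongrightarrow> j y" by (simp add: LIM_zero_iff)
    have "norm (approx_inv n (j y)) \<le> C * (t powr weight * M)" for n
    proof (rule Lim_bounded)
      show "(\<lambda>k. norm (approx_inv n (weighted_input (f k)))) \<longlonglongrightarrow> norm (approx_inv n (j y))"
        by (intro tendsto_norm bounded_linear.tendsto[OF approx_inv_lin lim])
      show "\<forall>k\<ge>0. norm (approx_inv n (weighted_input (f k))) \<le> C * (t powr weight * M)"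
        using C norm_f by (meson mult_left_mono less_imp_le order_trans)
    qed
    then have "norm y \<le> C * (t powr weight * M)"
      by (intro Lim_bounded[OF tendsto_norm[OF approx_inv_tendsto]]) auto
    with y show ?thesis by (auto simp: mult.assoc)
  qed
  with C(1) show ?thesis using that by blast
qed

end

section \<open>The response to an input on the half line\<close>

text \<open>
  From here on, the only trace of admissibility is this estimate, whose constant tends to \<open>0\<close> with \<open>t\<close>.
\<close>
locale bounded_input = extrapolated_semigroup S \<mu> j A1 S1
  for S :: "real \<Rightarrow> 'a::chilbert_space \<Rightarrow> 'a" and \<mu> and j :: "'a \<Rightarrow> 'b::chilbert_space"
    and A1 S1 +
  fixes B :: "'a \<Rightarrow> 'b" and T C a :: real
  assumes B: "bounded_clinear B" and T: "T > 0" and C: "C > 0" and a: "a > 0"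
    and input: "\<And>g t M. 0 \<le> t \<Longrightarrow> t \<le> T \<Longrightarrow> continuous_on {0..t} g \<Longrightarrow>
      (\<And>r. r \<in> {0..t} \<Longrightarrow> norm (g r) \<le> M) \<Longrightarrow>
      \<exists>y. j y = integral {0..t} (\<lambda>r. S1 r (B (g r))) \<and> norm y \<le> C * t powr a * M"
begin

lemmas B_lin = bounded_clinearD(1)[OF B]

lemmas S1_B_continuous_on = S1_compose_continuous_on[OF B_lin]

lemma S1_B_integrable:
  assumes "continuous_on {0..t} g"
  shows "(\<lambda>r. S1 r (B (g r))) integrable_on {0..t}"
  using assms by (intro integrable_continuous_real S1_B_continuous_on) auto

text \<open>
  The norm of the input map on the half line, in the space with weight \<open>e\<^sup>t\<close>: the period \<open>k\<close>
  contributes \<open>C T\<^sup>a e\<^sup>-\<^sup>k\<^sup>T\<close>, and these terms form a geometric series.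
\<close>
definition gain :: real where "gain = C * T powr a / (1 - exp (- T))"

lemma gain: "gain > 0" "C * T powr a + gain * exp (- T) = gain"
  using C T by (auto simp: gain_def field_simps)

lemma input_integral_split:
  assumes t: "t \<ge> 0" and s: "s \<ge> 0" and g: "continuous_on {0..t+s} g"
  shows "integral {0..t+s} (\<lambda>r. S1 r (B (g r)))
    = integral {0..t} (\<lambda>r. S1 r (B (g r))) + S1 t (integral {0..s} (\<lambda>r. S1 r (B (g (t + r)))))"
proof -
  have g': "continuous_on {0..s} (\<lambda>r. g (t + r))"
    using t by (intro continuous_on_compose2[OF g] continuous_intros) auto
  have "integral {0..t} (\<lambda>r. S1 r (B (g r))) + integral {t..t+s} (\<lambda>r. S1 r (B (g r)))
      = integral {0..t+s} (\<lambda>r. S1 r (B (g r)))"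
    using t s by (intro Henstock_Kurzweil_Integration.integral_combine S1_B_integrable g) auto
  moreover have "integral {t..t+s} (\<lambda>r. S1 r (B (g r))) = integral {0..s} (S1 t \<circ> (\<lambda>r. S1 r (B (g (t + r)))))"
  proof -
    have "integral {t..t+s} (\<lambda>r. S1 r (B (g r))) = integral {0..s} (\<lambda>r. S1 (r + t) (B (g (r + t))))"
      using integral_shift_real_ivl[of t t "t+s" "\<lambda>r. S1 r (B (g r))"] by simp
    also have "\<dots> = integral {0..s} (S1 t \<circ> (\<lambda>r. S1 r (B (g (t + r)))))"
    proof (intro integral_cong)
      fix r assume r: "r \<in> {0..s}"
      then show "S1 (r + t) (B (g (r + t))) = (S1 t \<circ> (\<lambda>r. S1 r (B (g (t + r))))) r"
        using S1_add[of t r "B (g (r + t))"] t by (simp add: add.commute)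
    qed
    finally show ?thesis .
  qed
  moreover have "integral {0..s} (S1 t \<circ> (\<lambda>r. S1 r (B (g (t + r))))) = S1 t (integral {0..s} (\<lambda>r. S1 r (B (g (t + r)))))"
    by (intro integral_linear S1_B_integrable g' S1_lin t)
  ultimately show ?thesis by simp
qed

text \<open>
  Induction on the number of periods of length \<open>T\<close>. The first period is controlled by the assumed
  estimate, the remainder is \<open>S T\<close> applied to a shorter integral.
\<close>
lemma input_integral:
  assumes t: "t \<ge> 0" and g: "continuous_on {0..t} g"
    and M: "\<And>r. r \<in> {0..t} \<Longrightarrow> norm (g r) \<le> M * exp (t - r)"
  shows "\<exists>y. j y = integral {0..t} (\<lambda>r. S1 r (B (g r))) \<and> norm y \<le> gain * M * exp t"
proof -
  have "\<exists>y. j y = integral {0..t} (\<lambda>r. S1 r (B (g r))) \<and> norm y \<le> gain * M * exp t"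
    if "0 \<le> t" "t \<le> real n * T" "continuous_on {0..t} g" "\<And>r. r \<in> {0..t} \<Longrightarrow> norm (g r) \<le> M * exp (t - r)"
    for n t g
    using that
  proof (induction n arbitrary: t g)
    case 0
    then have "t = 0" by simp
    have "norm (g 0) \<le> M" using 0(4)[of 0] \<open>t = 0\<close> by simp
    then have "M \<ge> 0" using norm_ge_zero order_trans by blast
    then show ?case using gain linear_0[OF bounded_linear.linear[OF j_lin]] \<open>t = 0\<close>
      by (intro exI[of _ 0]) auto
  next
    case (Suc n)
    have M0: "M \<ge> 0"
      using Suc.prems(1) norm_ge_zero[of "g 0"] Suc.prems(4)[of 0]
      by (smt (verit) atLeastAtMost_iff exp_gt_zero mult_neg_pos)
    have small: "norm (g r) \<le> M * exp t" if "r \<in> {0..t}" for r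
    proof -
      have "M * exp (t - r) \<le> M * exp t" using that M0 by (intro mult_left_mono) auto
      with Suc.prems(4)[OF that] show ?thesis by simp
    qed
    show ?case
    proof (cases "t \<le> T")
      case True
      obtain y where y: "j y = integral {0..t} (\<lambda>r. S1 r (B (g r)))" "norm y \<le> C * t powr a * (M * exp t)"
        using input[OF Suc.prems(1) True Suc.prems(3) small] by blast
      have "C * t powr a \<le> gain"
      proof -
        have "C * t powr a \<le> C * T powr a"
          using C a Suc.prems(1) True by (intro mult_left_mono powr_mono2) auto
        also have "\<dots> \<le> gain" using gain by (smt (verit) exp_gt_zero mult_pos_pos)
        finally show ?thesis .
      qed
      then have "C * t powr a * (M * exp t) \<le> gain * (M * exp t)"
        using M0 by (intro mult_right_mono) auto
      with y show ?thesis by (auto simp: mult.assoc)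
    next
      case False
      define s where "s = t - T"
      have s: "0 \<le> s" "t = T + s" using False by (auto simp: s_def)
      have g1: "continuous_on {0..T} g" using Suc.prems(3) by (rule continuous_on_subset) (use s in auto)
      have g2: "continuous_on {0..s} (\<lambda>r. g (T + r))"
        using T s by (intro continuous_on_compose2[OF Suc.prems(3)] continuous_intros) auto
      obtain y1 where y1: "j y1 = integral {0..T} (\<lambda>r. S1 r (B (g r)))" "norm y1 \<le> C * T powr a * (M * exp t)"
        using input[OF _ order_refl g1, of "M * exp t"] small s T by auto
      have "\<exists>y. j y = integral {0..s} (\<lambda>r. S1 r (B (g (T + r)))) \<and> norm y \<le> gain * M * exp s"
      proof (rule Suc.IH[OF s(1) _ g2])
        show "s \<le> real n * T" using Suc.prems(2) s by (simp add: algebra_simps)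
        show "norm (g (T + r)) \<le> M * exp (s - r)" if "r \<in> {0..s}" for r
          using Suc.prems(4)[of "T + r"] that T s by (simp add: algebra_simps)
      qed
      then obtain y2 where y2: "j y2 = integral {0..s} (\<lambda>r. S1 r (B (g (T + r))))" "norm y2 \<le> gain * M * exp s"
        by blast
      have "j (y1 + S T y2) = integral {0..t} (\<lambda>r. S1 r (B (g r)))"
        using input_integral_split[of T s g] T s Suc.prems(3) y1 y2
        by (simp add: linear_add[OF bounded_linear.linear[OF j_lin]] flip: S1_j)
      moreover have "norm (y1 + S T y2) \<le> gain * M * exp t"
      proof -
        have "norm (y1 + S T y2) \<le> norm y1 + norm y2"
          using norm_triangle_ineq[of y1 "S T y2"] S_contr[of T y2] T by simp
        also have "\<dots> \<le> C * T powr a * (M * exp t) + gain * M * exp s" using y1 y2 by simp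
        also have "exp s = exp (- T) * exp t" using s by (simp flip: exp_add)
        also have "C * T powr a * (M * exp t) + gain * M * (exp (- T) * exp t)
            = (C * T powr a + gain * exp (- T)) * M * exp t" by (simp add: algebra_simps)
        finally show ?thesis by (simp only: gain)
      qed
      ultimately show ?thesis by blast
    qed
  qed
  moreover obtain n :: nat where "t \<le> real n * T"
    using reals_Archimedean3[OF T] less_imp_le by blast
  ultimately show ?thesis using assms by blast
qed

text \<open>
  The function \<open>\<integral>\<^sub>0\<^sup>t S1(t-s) B u(s) ds\<close>, as an element of \<open>X\<close>. The integration variable is reversed, so
  that shifts of \<open>u\<close> act on the second factor alone.
\<close>
definition response :: "(real \<Rightarrow> 'a) \<Rightarrow> real \<Rightarrow> 'a"
  where "response u t = inv j (integral {0..t} (\<lambda>r. S1 r (B (u (t - r)))))"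

context
  fixes u :: "real \<Rightarrow> 'a"
  assumes u: "continuous_on {0..} u"
begin

lemma reversed_continuous_on: "continuous_on {0..t} (\<lambda>r. u (t - r))"
  by (intro continuous_on_compose2[OF u] continuous_intros) auto

lemma response_eqI:
  assumes "j y = integral {0..t} (\<lambda>r. S1 r (B (u (t - r))))"
  shows "response u t = y"
  unfolding response_def assms[symmetric] using inj_j by simp

lemma response_bound_exp:
  assumes t: "t \<ge> 0" and M: "\<And>s. s \<in> {0..t} \<Longrightarrow> norm (u s) \<le> M * exp s"
  shows "norm (response u t) \<le> gain * M * exp t"
  using input_integral[OF t reversed_continuous_on, of M] M response_eqI by auto

lemma response_bound_small:
  assumes t: "t \<ge> 0" "t \<le> T" and M: "\<And>s. s \<in> {0..t} \<Longrightarrow> norm (u s) \<le> M"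
  shows "norm (response u t) \<le> C * t powr a * M"
  using input[OF t reversed_continuous_on, of M] M response_eqI by auto

lemma j_response:
  assumes t: "t \<ge> 0"
  shows "j (response u t) = integral {0..t} (\<lambda>r. S1 r (B (u (t - r))))"
proof -
  have "compact ((\<lambda>r. u (t - r)) ` {0..t})"
    by (intro compact_continuous_image reversed_continuous_on) auto
  then obtain M where M: "\<And>r. r \<in> {0..t} \<Longrightarrow> norm (u (t - r)) \<le> M"
    using compact_imp_bounded bounded_iff by (metis imageI)
  have "norm (u (t - r)) \<le> M * exp (t - r)" if "r \<in> {0..t}" for r
  proof -
    have "M \<ge> 0" using M[OF that] norm_ge_zero order_trans by blast
    then have "M * 1 \<le> M * exp (t - r)" using that by (intro mult_left_mono) auto
    with M[OF that] show ?thesis by simp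
  qed
  then obtain y where "j y = integral {0..t} (\<lambda>r. S1 r (B (u (t - r))))"
    using input_integral[OF t reversed_continuous_on, of M] by blast
  then show ?thesis using response_eqI by metis
qed

lemma response_split:
  assumes t: "t \<ge> 0" and s: "s \<ge> 0"
  shows "response u (t + s) = S t (response u s) + response (\<lambda>r. u (s + r)) t"
proof (rule response_eqI)
  have u': "continuous_on {0..t} (\<lambda>r. u (s + (t - r)))"
    using s by (intro continuous_on_compose2[OF u] continuous_intros) auto
  have shift: "continuous_on {0..} (\<lambda>r. u (s + r))"
    using s by (intro continuous_on_compose2[OF u] continuous_intros) auto
  have "integral {0..t + s} (\<lambda>r. S1 r (B (u (t + s - r))))
      = integral {0..t} (\<lambda>r. S1 r (B (u (t + s - r)))) + S1 t (integral {0..s} (\<lambda>r. S1 r (B (u (t + s - (t + r))))))"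
    by (rule input_integral_split[OF t s reversed_continuous_on])
  also have "\<dots> = j (response (\<lambda>r. u (s + r)) t) + S1 t (j (response u s))"
    using bounded_input.j_response[OF bounded_input_axioms shift t] j_response[OF s]
    by (simp add: add.commute add_diff_eq)
  finally show "j (S t (response u s) + response (\<lambda>r. u (s + r)) t) = integral {0..t + s} (\<lambda>r. S1 r (B (u (t + s - r))))"
    by (simp add: linear_add[OF bounded_linear.linear[OF j_lin]] S1_j t)
qed

end

lemma response_combine:
  assumes u: "continuous_on {0..} u" and v: "continuous_on {0..} v" and t: "t \<ge> 0"
  shows "response (\<lambda>s. u s + v s) t = response u t + response v t"
    and "response (\<lambda>s. u s - v s) t = response u t - response v t"
proof -
  have lin: "linear (\<lambda>x. S1 r (B x))" if "r \<ge> 0" for r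
    using bounded_linear_compose[OF S1_lin[OF that] B_lin] by (rule bounded_linear.linear)
  show "response (\<lambda>s. u s + v s) t = response u t + response v t"
  proof (rule response_eqI)
    have "integral {0..t} (\<lambda>r. S1 r (B (u (t - r) + v (t - r))))
        = integral {0..t} (\<lambda>r. S1 r (B (u (t - r))) + S1 r (B (v (t - r))))"
      by (intro integral_cong) (simp add: linear_add[OF lin])
    then show "j (response u t + response v t) = integral {0..t} (\<lambda>r. S1 r (B (u (t - r) + v (t - r))))"
      by (simp add: linear_add[OF bounded_linear.linear[OF j_lin]] j_response u v t integral_add
          S1_B_integrable reversed_continuous_on)
  qed (intro continuous_intros u v)
  show "response (\<lambda>s. u s - v s) t = response u t - response v t"
  proof (rule response_eqI)
    have "integral {0..t} (\<lambda>r. S1 r (B (u (t - r) - v (t - r))))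
        = integral {0..t} (\<lambda>r. S1 r (B (u (t - r))) - S1 r (B (v (t - r))))"
      by (intro integral_cong) (simp add: linear_diff[OF lin])
    then show "j (response u t - response v t) = integral {0..t} (\<lambda>r. S1 r (B (u (t - r) - v (t - r))))"
      by (simp add: linear_diff[OF bounded_linear.linear[OF j_lin]] j_response u v t integral_diff
          S1_B_integrable reversed_continuous_on)
  qed (intro continuous_intros u v)
qed

lemma response_scaleC:
  assumes u: "continuous_on {0..} u" and t: "t \<ge> 0"
  shows "response (\<lambda>s. c *\<^sub>C u s) t = c *\<^sub>C response u t"
proof (rule response_eqI)
  show "continuous_on {0..} (\<lambda>s. c *\<^sub>C u s)"
    by (intro bounded_linear.continuous_on[OF bounded_linear_scaleC] u)
  have "integral {0..t} (\<lambda>r. S1 r (B (c *\<^sub>C u (t - r)))) = integral {0..t} ((\<lambda>w. c *\<^sub>C w) \<circ> (\<lambda>r. S1 r (B (u (t - r)))))"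
    by (intro integral_cong) (simp add: bounded_clinearD(2)[OF B] bounded_clinearD(2)[OF S1_clin])
  also have "\<dots> = c *\<^sub>C integral {0..t} (\<lambda>r. S1 r (B (u (t - r))))"
    by (intro integral_linear bounded_linear_scaleC S1_B_integrable reversed_continuous_on u)
  finally show "j (c *\<^sub>C response u t) = integral {0..t} (\<lambda>r. S1 r (B (c *\<^sub>C u (t - r))))"
    by (simp add: j_scaleC j_response u t)
qed

text \<open>
  The increment from \<open>s\<close> to \<open>s + h\<close> is the response over \<open>[0, h]\<close> transported by \<open>S s\<close>, which is
  small since \<open>h\<^sup>a\<close> is, plus the response to \<open>u(h + r) - u(r)\<close>, which is small by uniform
  continuity. Both bounds are uniform on bounded intervals, hence give continuity from both sides.
\<close>
lemma response_continuous_on: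
  assumes u: "continuous_on {0..} u"
  shows "continuous_on {0..} (response u)"
  unfolding continuous_on_iff
proof (intro ballI allI impI)
  fix t0 e :: real assume t0: "t0 \<in> {0..}" and e: "e > 0"
  define b where "b = t0 + 1"
  have "compact (u ` {0..b})"
    by (intro compact_continuous_image continuous_on_subset[OF u]) auto
  then obtain M where M: "M > 0" "\<And>s. s \<in> {0..b} \<Longrightarrow> norm (u s) \<le> M"
    using compact_imp_bounded bounded_pos by (metis imageI)
  define \<epsilon> where "\<epsilon> = e / (2 * gain * exp b)"
  have \<epsilon>: "\<epsilon> > 0" using e gain by (simp add: \<epsilon>_def)
  have "uniformly_continuous_on {0..b} u"
    by (intro compact_uniformly_continuous continuous_on_subset[OF u]) auto
  then obtain d1 where d1: "d1 > 0" "\<And>s s'. s \<in> {0..b} \<Longrightarrow> s' \<in> {0..b} \<Longrightarrow> dist s' s < d1 \<Longrightarrow> dist (u s') (u s) < \<epsilon>"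
    using \<epsilon> unfolding uniformly_continuous_on_def by metis
  have "((\<lambda>h. C * h powr a * M) \<longlongrightarrow> C * 0 powr a * M) (at_right 0)"
    using a by (intro tendsto_intros tendsto_powr') (auto simp: eventually_at_right_field intro!: exI[of _ 1])
  then have "\<forall>\<^sub>F h in at_right 0. C * h powr a * M < e / 2"
    by (rule order_tendstoD) (use e in simp)
  then obtain d2 where d2: "d2 > 0" "\<And>h. h > 0 \<Longrightarrow> h < d2 \<Longrightarrow> C * h powr a * M < e / 2"
    unfolding eventually_at_right_field by auto
  have step: "norm (response u t - response u s) < e"
    if st: "0 \<le> s" "s < t" "t \<le> b" "t - s < d1" "t - s < d2" "t - s < T" for s t
  proof -
    define h where "h = t - s"
    have h: "0 < h" "h < d1" "h < d2" "h < T" "t = s + h" using st by (auto simp: h_def)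
    have shift: "continuous_on {0..} (\<lambda>r. u (h + r))"
      using h by (intro continuous_on_compose2[OF u] continuous_intros) auto
    have "response u t - response u s = S s (response u h) + response (\<lambda>r. u (h + r) - u r) s"
      unfolding h(5) using response_split[OF u st(1), of h] response_combine(2)[OF shift u st(1)] h(1) by simp
    also have "norm \<dots> \<le> norm (response u h) + norm (response (\<lambda>r. u (h + r) - u r) s)"
      using norm_triangle_ineq S_contr[OF st(1), of "response u h"] by (smt (verit))
    also have "norm (response u h) \<le> C * h powr a * M"
      by (intro response_bound_small u) (use h st M in auto)
    also have "norm (response (\<lambda>r. u (h + r) - u r) s) \<le> gain * \<epsilon> * exp s"
    proof (intro response_bound_exp st continuous_intros shift u)
      fix r assume r: "r \<in> {0..s}"
      have "dist (u (h + r)) (u r) < \<epsilon>" by (rule d1(2)) (use h r st in \<open>auto simp: dist_real_def\<close>)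
      also have "\<epsilon> * 1 \<le> \<epsilon> * exp r" using \<epsilon> r by (intro mult_left_mono) auto
      finally show "norm (u (h + r) - u r) \<le> \<epsilon> * exp r" by (simp add: dist_norm)
    qed
    also have "gain * \<epsilon> * exp s \<le> gain * \<epsilon> * exp b" using gain \<epsilon> st by (intro mult_left_mono) auto
    also have "gain * \<epsilon> * exp b = e / 2" using gain by (simp add: \<epsilon>_def)
    finally show ?thesis using d2(2)[of h] h by simp
  qed
  show "\<exists>d>0. \<forall>s\<in>{0..}. dist s t0 < d \<longrightarrow> dist (response u s) (response u t0) < e"
  proof (intro exI[of _ "min (min d1 d2) (min T 1)"] conjI ballI impI)
    fix s assume s: "s \<in> {0..}" "dist s t0 < min (min d1 d2) (min T 1)"
    consider "s = t0" | "s < t0" | "s > t0" by linarith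
    then show "dist (response u s) (response u t0) < e"
    proof cases
      case 2
      then show ?thesis using step[of s t0] s t0 by (auto simp: dist_real_def dist_norm b_def norm_minus_commute)
    next
      case 3
      then show ?thesis using step[of t0 s] s t0 by (auto simp: dist_real_def dist_norm b_def)
    qed (use e in simp)
  qed (use d1 d2 T in auto)
qed

end

section \<open>The perturbed semigroup\<close>

text \<open>
  The best constant \<open>M\<close> in \<open>norm (v t) \<le> M e\<^sup>t\<close> satisfies \<open>M \<le> m + q M\<close>. With \<open>m = 0\<close> this
  gives uniqueness of mild solutions, with \<open>m = norm x\<close> their growth bound.
\<close>
lemma weighted_bound_improve:
  fixes v :: "real \<Rightarrow> 'a::real_normed_vector"
  assumes M: "\<And>t. t \<ge> 0 \<Longrightarrow> norm (v t) \<le> M * exp t" and q: "q < 1"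
    and step: "\<And>M t. (\<And>t. t \<ge> 0 \<Longrightarrow> norm (v t) \<le> M * exp t) \<Longrightarrow> t \<ge> 0 \<Longrightarrow> norm (v t) \<le> (m + q * M) * exp t"
    and t: "t \<ge> 0"
  shows "norm (v t) \<le> m / (1 - q) * exp t"
proof -
  define W where "W = (\<lambda>t. norm (v t) * exp (- t)) ` {0..}"
  have bdd: "bdd_above W"
    unfolding W_def using M by (intro bdd_aboveI2[where M = M]) (simp add: exp_minus field_simps)
  have le: "norm (v t) \<le> Sup W * exp t" if "t \<ge> 0" for t
  proof -
    have "norm (v t) * exp (- t) \<le> Sup W" using that bdd by (intro cSup_upper) (auto simp: W_def)
    then show ?thesis by (simp add: exp_minus field_simps)
  qed
  have "Sup W \<le> m + q * Sup W"
  proof (rule cSup_least)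
    fix y assume "y \<in> W"
    then obtain t where t: "t \<ge> 0" "y = norm (v t) * exp (- t)" by (auto simp: W_def)
    have "y \<le> (m + q * Sup W) * exp t * exp (- t)"
      unfolding t(2) by (intro mult_right_mono step[OF le t(1)]) auto
    then show "y \<le> m + q * Sup W" by (simp add: mult.assoc flip: exp_add)
  qed (auto simp: W_def)
  then have "Sup W \<le> m / (1 - q)" using q by (simp add: field_simps)
  then have "Sup W * exp t \<le> m / (1 - q) * exp t" by (intro mult_right_mono) auto
  with le[OF t] show ?thesis by simp
qed

locale perturbed_semigroup = bounded_input S \<mu> j A1 S1 B T C a
  for S :: "real \<Rightarrow> 'a::chilbert_space \<Rightarrow> 'a" and \<mu> and j :: "'a \<Rightarrow> 'b::chilbert_space"
    and A1 S1 B T C a +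
  fixes \<rho> :: real
  assumes \<rho>: "\<rho> > 0" and \<rho>_gain: "\<rho> * gain < 1"
begin

text \<open>
  The growth condition makes the solution unique without appeal to local arguments.
\<close>
definition mild :: "(real \<Rightarrow> 'a) \<Rightarrow> 'a \<Rightarrow> bool"
  where "mild u x \<longleftrightarrow> continuous_on {0..} u \<and> (\<exists>M. \<forall>t\<ge>0. norm (u t) \<le> M * exp t) \<and>
    (\<forall>t\<ge>0. u t = S t x - \<rho> *\<^sub>R response u t)"

lemma mildD:
  assumes "mild u x"
  shows "continuous_on {0..} u" "t \<ge> 0 \<Longrightarrow> u t = S t x - \<rho> *\<^sub>R response u t"
  using assms by (auto simp: mild_def)

lemma mild_bound:
  assumes u: "mild u x" and t: "t \<ge> 0"
  shows "norm (u t) \<le> norm x / (1 - \<rho> * gain) * exp t"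
proof -
  obtain M where M: "\<And>t. t \<ge> 0 \<Longrightarrow> norm (u t) \<le> M * exp t" using u unfolding mild_def by blast
  show ?thesis
  proof (rule weighted_bound_improve[OF M \<rho>_gain _ t])
    fix M t assume M: "\<And>t. t \<ge> 0 \<Longrightarrow> norm (u t) \<le> M * exp t" and t: "t \<ge> (0::real)"
    have "norm (u t) \<le> norm (S t x) + norm (\<rho> *\<^sub>R response u t)"
      unfolding mildD(2)[OF u t] by (rule norm_triangle_ineq4)
    also have "norm (S t x) \<le> norm x * exp t"
    proof -
      have "norm (S t x) \<le> norm x * 1" using S_contr[OF t] by simp
      also have "\<dots> \<le> norm x * exp t" using t by (intro mult_left_mono) auto
      finally show ?thesis .
    qed
    also have "norm (\<rho> *\<^sub>R response u t) \<le> \<rho> * (gain * M * exp t)"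
      using \<rho> response_bound_exp[OF mildD(1)[OF u] t, of M] M by simp
    finally show "norm (u t) \<le> (norm x + \<rho> * gain * M) * exp t" by (simp add: algebra_simps)
  qed
qed

lemma mild_add:
  assumes u: "mild u x" and v: "mild v y"
  shows "mild (\<lambda>t. u t + v t) (x + y)"
proof -
  obtain M where M: "\<And>t. t \<ge> 0 \<Longrightarrow> norm (u t) \<le> M * exp t" using u unfolding mild_def by blast
  obtain N where N: "\<And>t. t \<ge> 0 \<Longrightarrow> norm (v t) \<le> N * exp t" using v unfolding mild_def by blast
  have "norm (u t + v t) \<le> (M + N) * exp t" if "t \<ge> 0" for t
    using norm_triangle_ineq[of "u t" "v t"] M[OF that] N[OF that] by (simp add: algebra_simps)
  moreover have "u t + v t = S t (x + y) - \<rho> *\<^sub>R response (\<lambda>t. u t + v t) t" if t: "t \<ge> 0" for t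
  proof -
    have "u t + v t = (S t x - \<rho> *\<^sub>R response u t) + (S t y - \<rho> *\<^sub>R response v t)"
      by (simp only: mildD(2)[OF u t, symmetric] mildD(2)[OF v t, symmetric])
    then show ?thesis
      by (simp add: response_combine mildD(1)[OF u] mildD(1)[OF v] t
        linear_add[OF bounded_linear.linear[OF S_lin]] scaleR_add_right)
  qed
  ultimately show ?thesis
    unfolding mild_def using mildD(1)[OF u] mildD(1)[OF v] by (auto intro!: continuous_intros)
qed

lemma mild_scaleC:
  assumes u: "mild u x"
  shows "mild (\<lambda>t. c *\<^sub>C u t) (c *\<^sub>C x)"
proof -
  interpret c: bounded_linear "\<lambda>x::'a. c *\<^sub>C x" by (rule bounded_linear_scaleC)
  obtain M where M: "\<And>t. t \<ge> 0 \<Longrightarrow> norm (u t) \<le> M * exp t" using u unfolding mild_def by blast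
  have "norm (c *\<^sub>C u t) \<le> (cmod c * M) * exp t" if "t \<ge> 0" for t
    using mult_left_mono[OF M[OF that], of "cmod c"] by (simp add: norm_scaleC mult.assoc)
  moreover have "c *\<^sub>C u t = S t (c *\<^sub>C x) - \<rho> *\<^sub>R response (\<lambda>t. c *\<^sub>C u t) t" if t: "t \<ge> 0" for t
  proof -
    have "c *\<^sub>C u t = c *\<^sub>C S t x - \<rho> *\<^sub>R (c *\<^sub>C response u t)"
      by (subst mildD(2)[OF u t]) (simp add: c.diff c.scaleR)
    then show ?thesis
      by (simp add: response_scaleC[OF mildD(1)[OF u] t] bounded_clinearD(2)[OF C0_semigroupD(1)[OF S_C0 t]])
  qed
  moreover have "continuous_on {0..} (\<lambda>t. c *\<^sub>C u t)" by (intro c.continuous_on mildD(1)[OF u])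
  ultimately show ?thesis unfolding mild_def by blast
qed

lemma mild_unique:
  assumes u: "mild u x" and v: "mild v x" and t: "t \<ge> 0"
  shows "u t = v t"
proof -
  have m: "(-1) *\<^sub>C z = - z" for z :: 'a
    using scaleC_complex_of_real[of "-1" z] by simp
  have "mild (\<lambda>t. u t + (-1) *\<^sub>C v t) (x + (-1) *\<^sub>C x)" by (intro mild_add mild_scaleC u v)
  then have "mild (\<lambda>t. u t - v t) 0" by (simp add: m)
  from mild_bound[OF this t] show ?thesis by simp
qed

text \<open>
  The function \<open>f(t) = e\<^sup>-\<^sup>t u(t)\<close> is sought among the bounded continuous functions on the real
  line; times \<open>t < 0\<close> are assigned the value at \<open>0\<close>. The fixed point map is Lipschitz with
  constant \<open>\<rho> gain < 1\<close>.
\<close>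
lemma mild_exists: "\<exists>u. mild u x"
proof -
  define ex :: "(real \<Rightarrow>\<^sub>C 'a) \<Rightarrow> real \<Rightarrow> 'a" where "ex f s = exp s *\<^sub>R f s" for f s
  define \<Gamma> where "\<Gamma> f t = exp (- max 0 t) *\<^sub>R (S (max 0 t) x - \<rho> *\<^sub>R response (ex f) (max 0 t))" for f t
  have ex: "continuous_on X (ex f)" for X f unfolding ex_def by (intro continuous_intros) auto
  have max: "continuous_on UNIV (max 0 :: real \<Rightarrow> real)" by (intro continuous_intros)
  have diff: "norm (response (ex f) t - response (ex g) t) \<le> gain * dist f g * exp t" if t: "t \<ge> 0" for f g t
  proof -
    have "response (ex f) t - response (ex g) t = response (\<lambda>s. ex f s - ex g s) t"
      by (rule response_combine(2)[OF ex ex t, symmetric])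
    also have "norm \<dots> \<le> gain * dist f g * exp t"
    proof (intro response_bound_exp t continuous_intros ex)
      fix s
      have "norm (ex f s - ex g s) = exp s * dist (f s) (g s)"
        by (simp add: ex_def dist_norm flip: scaleR_diff_right)
      also have "\<dots> \<le> exp s * dist f g" by (intro mult_left_mono dist_bounded) auto
      finally show "norm (ex f s - ex g s) \<le> dist f g * exp s" by (simp add: mult.commute)
    qed
    finally show ?thesis .
  qed
  have \<Gamma>_bcontfun: "\<Gamma> f \<in> bcontfun" for f
  proof (rule bcontfun_normI)
    show "continuous_on UNIV (\<Gamma> f)"
      unfolding \<Gamma>_def
      by (intro continuous_intros continuous_on_compose2[OF response_continuous_on[OF ex] max]
        continuous_on_compose2[OF contraction_semigroup_continuous[OF S] max]) auto
    fix t :: real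
    define \<tau> where "\<tau> = max 0 t"
    have \<tau>: "\<tau> \<ge> 0" by (simp add: \<tau>_def)
    have "norm (response (ex f) \<tau>) \<le> gain * norm f * exp \<tau>"
      by (intro response_bound_exp \<tau> ex) (simp add: ex_def norm_bounded mult.commute mult_left_mono)
    then have "norm (\<rho> *\<^sub>R response (ex f) \<tau>) \<le> \<rho> * (gain * norm f * exp \<tau>)" using \<rho> by simp
    then have "norm (S \<tau> x - \<rho> *\<^sub>R response (ex f) \<tau>) \<le> norm x + \<rho> * (gain * norm f * exp \<tau>)"
      using norm_triangle_ineq4[of "S \<tau> x" "\<rho> *\<^sub>R response (ex f) \<tau>"] S_contr[OF \<tau>, of x] by linarith
    also have "\<dots> \<le> norm x * exp \<tau> + \<rho> * (gain * norm f * exp \<tau>)"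
      using mult_left_mono[of 1 "exp \<tau>" "norm x"] \<tau> by simp
    finally have "exp (- \<tau>) * norm (S \<tau> x - \<rho> *\<^sub>R response (ex f) \<tau>) \<le> norm x + \<rho> * gain * norm f"
      by (simp add: exp_minus field_simps)
    then show "norm (\<Gamma> f t) \<le> norm x + \<rho> * gain * norm f" by (simp add: \<Gamma>_def \<tau>_def)
  qed
  have \<Gamma>: "apply_bcontfun (Bcontfun (\<Gamma> f)) t = \<Gamma> f t" for f t
    by (simp add: Bcontfun_inverse[OF \<Gamma>_bcontfun])
  have "\<exists>!f. Bcontfun (\<Gamma> f) = f"
  proof (rule banach_fix_type)
    show "0 \<le> \<rho> * gain" "\<rho> * gain < 1" using \<rho> gain \<rho>_gain by auto
    show "\<forall>f g. dist (Bcontfun (\<Gamma> f)) (Bcontfun (\<Gamma> g)) \<le> \<rho> * gain * dist f g"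
    proof (intro allI dist_bound)
      fix f g and t :: real
      define \<tau> where "\<tau> = max 0 t"
      have \<tau>: "\<tau> \<ge> 0" by (simp add: \<tau>_def)
      have "\<Gamma> f t - \<Gamma> g t = (exp (- \<tau>) * \<rho>) *\<^sub>R (response (ex g) \<tau> - response (ex f) \<tau>)"
        by (simp add: \<Gamma>_def \<tau>_def scaleR_diff_right)
      then have "dist (\<Gamma> f t) (\<Gamma> g t) = exp (- \<tau>) * \<rho> * norm (response (ex g) \<tau> - response (ex f) \<tau>)"
        using \<rho> by (simp add: dist_norm abs_mult)
      also have "\<dots> \<le> exp (- \<tau>) * \<rho> * (gain * dist g f * exp \<tau>)"
        using \<rho> diff[OF \<tau>] by (intro mult_left_mono) auto
      also have "\<dots> = \<rho> * gain * dist f g" by (simp add: exp_minus dist_commute)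
      finally show "dist (Bcontfun (\<Gamma> f) t) (Bcontfun (\<Gamma> g) t) \<le> \<rho> * gain * dist f g"
        by (simp add: \<Gamma>)
    qed
  qed
  then obtain f where f: "Bcontfun (\<Gamma> f) = f" by blast
  have "mild (ex f) x"
    unfolding mild_def
  proof (intro conjI allI impI exI ex)
    show "norm (ex f t) \<le> norm f * exp t" for t
      by (simp add: ex_def norm_bounded mult.commute mult_left_mono)
    fix t :: real assume t: "t \<ge> 0"
    have "f t = exp (- t) *\<^sub>R (S t x - \<rho> *\<^sub>R response (ex f) t)"
      using \<Gamma>[of f t] t by (simp add: f \<Gamma>_def)
    then show "ex f t = S t x - \<rho> *\<^sub>R response (ex f) t"
      by (simp add: ex_def exp_minus)
  qed
  then show ?thesis by blast
qed

definition V :: "real \<Rightarrow> 'a \<Rightarrow> 'a" where "V t x = (SOME u. mild u x) t"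

lemma V_mild: "mild (\<lambda>t. V t x) x"
  unfolding V_def using someI_ex[OF mild_exists] by simp

lemmas V_continuous_on = mildD(1)[OF V_mild]
lemmas V_eq = mildD(2)[OF V_mild]
lemmas V_bound = mild_bound[OF V_mild]

lemma response_0: "continuous_on {0..} u \<Longrightarrow> response u 0 = 0"
  using response_bound_small[of u 0 "norm (u 0)"] T by simp

lemma V_0: "V 0 x = x"
  using V_eq[of 0 x] by (simp add: S_0 response_0[OF V_continuous_on])

text \<open>
  The shifted solution is mild for the initial state \<open>V t x\<close>, by \<open>response_split\<close>.
\<close>
lemma V_add:
  assumes s: "s \<ge> 0" and t: "t \<ge> 0"
  shows "V (s + t) x = V s (V t x)"
proof -
  let ?u = "\<lambda>s. V (t + s) x"
  have c: "continuous_on {0..} ?u"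
    using t by (intro continuous_on_compose2[OF V_continuous_on] continuous_intros) auto
  have "mild ?u (V t x)"
    unfolding mild_def
  proof (intro conjI allI impI exI c)
    fix s :: real assume s: "s \<ge> 0"
    show "norm (?u s) \<le> norm x / (1 - \<rho> * gain) * exp t * exp s"
      using V_bound[of "t + s" x] s t by (simp add: exp_add mult.assoc)
    interpret Ss: bounded_linear "S s" using s by (rule S_lin)
    have "?u s = S s (S t x) - \<rho> *\<^sub>R (S s (response (\<lambda>r. V r x) t) + response ?u s)"
      using V_eq[of "s + t" x] s t response_split[OF V_continuous_on s t, of x]
      by (simp add: S_add add.commute)
    also have "\<dots> = S s (V t x) - \<rho> *\<^sub>R response ?u s"
      by (subst V_eq[OF t]) (simp add: Ss.diff Ss.scaleR scaleR_add_right)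
    finally show "?u s = S s (V t x) - \<rho> *\<^sub>R response ?u s" .
  qed
  from mild_unique[OF this V_mild s] show ?thesis by (simp add: add.commute)
qed

lemma V_C0_semigroup: "C0_semigroup V"
  unfolding C0_semigroup_def
proof (intro conjI allI impI V_0 V_add)
  fix t :: real and x
  show "bounded_clinear (V t)" if t: "t \<ge> 0"
    unfolding bounded_clinear_def
  proof (intro conjI allI)
    show c: "V t (c *\<^sub>C x) = c *\<^sub>C V t x" for c x
      by (rule mild_unique[OF V_mild mild_scaleC[OF V_mild] t])
    show "bounded_linear (V t)"
    proof
      show "V t (x + y) = V t x + V t y" for x y
        by (rule mild_unique[OF V_mild mild_add[OF V_mild V_mild] t])
      show "V t (r *\<^sub>R x) = r *\<^sub>R V t x" for r x
        using c[of "of_real r" x] by (simp add: scaleC_complex_of_real)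
      have "norm (V t x) \<le> norm x * (exp t / (1 - \<rho> * gain))" for x using V_bound[OF t, of x] by simp
      then show "\<exists>K. \<forall>x. norm (V t x) \<le> norm x * K" by blast
    qed
  qed
  have "((\<lambda>t. V t x) \<longlongrightarrow> V 0 x) (at 0 within {0..})"
    using V_continuous_on by (simp add: continuous_on_def)
  then show "((\<lambda>t. V t x) \<longlongrightarrow> x) (at_right 0)"
    unfolding V_0 by (rule tendsto_within_subset) auto
qed

lemma j_response_const:
  assumes "t \<ge> 0"
  shows "j (response (\<lambda>_. x) t) = integral {0..t} (\<lambda>r. S1 r (B x))"
  using j_response[OF continuous_on_const assms] .

text \<open>
  Over short times \<open>V s x\<close> is compared with its initial value, for which the response is explicit.
\<close>
lemma V_diff_eq:
  assumes t: "t \<ge> 0"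
  shows "response (\<lambda>s. V s x) t = response (\<lambda>_. x) t + response (\<lambda>s. V s x - x) t"
  using response_combine(2)[OF V_continuous_on continuous_on_const t, of x x] by simp

lemma S1_orbit_average: "((\<lambda>h. integral {0..h} (\<lambda>r. S1 r w) /\<^sub>R h) \<longlongrightarrow> w) (at_right 0)"
  using integral_average_tendsto[OF contraction_semigroup_continuous[OF S1_contraction], of w]
  by (simp add: S1_0)

lemma response_average_tendsto:
  "((\<lambda>h. j (response (\<lambda>s. V s x) h) /\<^sub>R h) \<longlongrightarrow> B x) (at_right 0)"
proof -
  let ?w = "\<lambda>s. V s x - x"
  have w: "continuous_on {0..} ?w" by (intro continuous_intros V_continuous_on)
  obtain K where K: "K > 0" "\<And>x. norm (B x) \<le> norm x * K"
    using bounded_linear.pos_bounded[OF B_lin] by blast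
  have "((\<lambda>h. j (response ?w h) /\<^sub>R h) \<longlongrightarrow> 0) (at_right 0)"
  proof (rule tendstoI)
    fix e :: real assume e: "e > 0"
    define e' where "e' = e / (2 * K)"
    have e': "e' > 0" using e K by (simp add: e'_def)
    have "((\<lambda>t. V t x) \<longlongrightarrow> x) (at_right 0)" using C0_semigroupD(5)[OF V_C0_semigroup] .
    then have "\<forall>\<^sub>F t in at_right 0. dist (V t x) x < e'" using e' by (rule tendstoD)
    then obtain d where d: "d > 0" "\<And>t. t > 0 \<Longrightarrow> t < d \<Longrightarrow> dist (V t x) x < e'"
      unfolding eventually_at_right_field by auto
    show "\<forall>\<^sub>F h in at_right 0. dist (j (response ?w h) /\<^sub>R h) 0 < e"
      unfolding eventually_at_right_field
    proof (intro exI[of _ d] conjI allI impI d(1))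
      fix h assume h: "h > 0" "h < d"
      have "norm (j (response ?w h)) \<le> (e' * K) * (h - 0)"
        unfolding j_response[OF w less_imp_le[OF h(1)]]
      proof (rule integral_bound)
        show "continuous_on {0..h} (\<lambda>r. S1 r (B (V (h - r) x - x)))"
          by (intro S1_B_continuous_on reversed_continuous_on[OF w] continuous_intros) auto
        fix r assume r: "r \<in> {0..h}"
        have "norm (V (h - r) x - x) \<le> e'"
          using d(2)[of "h - r"] r h e' by (cases "r = h") (auto simp: V_0 dist_norm)
        then have "norm (V (h - r) x - x) * K \<le> e' * K" using K by simp
        with K(2)[of "V (h - r) x - x"] S1_contr[of r "B (V (h - r) x - x)"] r
        show "norm (S1 r (B (V (h - r) x - x))) \<le> e' * K" by simp
      qed (use h in simp)
      also have "(e' * K) * (h - 0) = e / 2 * h" using K by (simp add: e'_def)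
      also have "\<dots> < e * h" using e h by simp
      finally show "dist (j (response ?w h) /\<^sub>R h) 0 < e"
        using h by (simp add: divide_inverse_commute[symmetric] pos_divide_less_eq)
    qed
  qed
  then have "((\<lambda>h. integral {0..h} (\<lambda>r. S1 r (B x)) /\<^sub>R h + j (response ?w h) /\<^sub>R h) \<longlongrightarrow> B x + 0) (at_right 0)"
    by (intro tendsto_add S1_orbit_average)
  then have "((\<lambda>h. j (response (\<lambda>s. V s x) h) /\<^sub>R h) \<longlongrightarrow> B x + 0) (at_right 0)"
    by (rule Lim_transform_eventually)
      (auto simp: eventually_at_right_field V_diff_eq linear_add[OF bounded_linear.linear[OF j_lin]]
        j_response_const scaleR_add_right intro!: exI[of _ 1])
  then show ?thesis by simp
qed

text \<open>
  If \<open>(x, y)\<close> is in the generator, then the difference quotients converge in \<open>X\<^sub>-\<^sub>1\<close> as well, and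
  there their limit is \<open>A1 x - \<rho> B x\<close>.

  Conversely, let \<open>A1 x - \<rho> B x = j y\<close>. Then \<open>w(t) = V(t)x - x\<close> satisfies
  \<open>w(t) = \<integral>\<^sub>0\<^sup>t S(s)y ds - \<rho> response w t\<close>. For small \<open>h\<close> the estimate of the response makes
  the last term at most half the supremum of \<open>norm w\<close> over \<open>[0, h]\<close>, so that \<open>w = O(h)\<close> there; a second
  use of the estimate makes that term \<open>O(h\<^sup>1\<^sup>+\<^sup>a)\<close>, and the difference quotients converge to \<open>y\<close> in \<open>X\<close>.
\<close>
lemma V_generator: "generator V = part_in j (\<lambda>x. A1 x - \<rho> *\<^sub>R B x)"
proof (intro equalityI subrelI)
  interpret j: bounded_linear j by (rule j_lin)
  fix x y assume "(x, y) \<in> generator V"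
  then have "((\<lambda>t. (V t x - x) /\<^sub>R t) \<longlongrightarrow> y) (at_right 0)" by (simp add: generator_def)
  then have 1: "((\<lambda>t. j ((V t x - x) /\<^sub>R t)) \<longlongrightarrow> j y) (at_right 0)" by (rule j.tendsto)
  have "((\<lambda>h. integral {0..h} (\<lambda>r. S1 r (A1 x)) /\<^sub>R h - \<rho> *\<^sub>R (j (response (\<lambda>s. V s x) h) /\<^sub>R h)) \<longlongrightarrow> A1 x - \<rho> *\<^sub>R B x) (at_right 0)"
    by (intro tendsto_intros S1_orbit_average response_average_tendsto)
  then have 2: "((\<lambda>t. j ((V t x - x) /\<^sub>R t)) \<longlongrightarrow> A1 x - \<rho> *\<^sub>R B x) (at_right 0)"
  proof (rule Lim_transform_eventually)
    have "integral {0..h} (\<lambda>r. S1 r (A1 x)) /\<^sub>R h - \<rho> *\<^sub>R (j (response (\<lambda>s. V s x) h) /\<^sub>R h) = j ((V h x - x) /\<^sub>R h)"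
      if h: "h > 0" for h
    proof -
      have "V h x - x = (S h x - x) - \<rho> *\<^sub>R response (\<lambda>s. V s x) h"
        using V_eq[of h x] h by simp
      then have "j ((V h x - x) /\<^sub>R h)
          = ((j (S h x) - j x) - \<rho> *\<^sub>R j (response (\<lambda>s. V s x) h)) /\<^sub>R h"
        by (simp only: j.scaleR j.diff)
      also have "j (S h x) - j x = integral {0..h} (\<lambda>r. S1 r (A1 x))"
        using S1_orbit[of h x] h by simp
      finally show ?thesis by (simp add: scaleR_diff_right mult.commute)
    qed
    then show "\<forall>\<^sub>F h in at_right 0. integral {0..h} (\<lambda>r. S1 r (A1 x)) /\<^sub>R h - \<rho> *\<^sub>R (j (response (\<lambda>s. V s x) h) /\<^sub>R h)
        = j ((V h x - x) /\<^sub>R h)"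
      by (auto simp: eventually_at_right_field intro!: exI[of _ 1])
  qed
  show "(x, y) \<in> part_in j (\<lambda>x. A1 x - \<rho> *\<^sub>R B x)"
    using tendsto_unique[OF trivial_limit_at_right_real 2 1] by (simp add: part_in_def)
next
  interpret j: bounded_linear j by (rule j_lin)
  fix x y assume "(x, y) \<in> part_in j (\<lambda>x. A1 x - \<rho> *\<^sub>R B x)"
  then have xy: "A1 x - \<rho> *\<^sub>R B x = j y" by (simp add: part_in_def)
  let ?w = "\<lambda>s. V s x - x"
  have w: "continuous_on {0..} ?w" by (intro continuous_intros V_continuous_on)
  have eq: "?w t = integral {0..t} (\<lambda>s. S s y) - \<rho> *\<^sub>R response ?w t" if t: "t \<ge> 0" for t
  proof -
    have c: "continuous_on {0..t} (\<lambda>s. S1 s z)" for z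
      by (rule continuous_on_subset[OF contraction_semigroup_continuous[OF S1_contraction]]) auto
    have "j (S t x - x - \<rho> *\<^sub>R response (\<lambda>_. x) t)
        = integral {0..t} (\<lambda>s. S1 s (A1 x)) - \<rho> *\<^sub>R integral {0..t} (\<lambda>s. S1 s (B x))"
      using S1_orbit[OF t, of x] j_response_const[OF t, of x] by (simp add: j.diff j.scaleR)
    also have "\<dots> = integral {0..t} (\<lambda>s. S1 s (A1 x) - \<rho> *\<^sub>R S1 s (B x))"
      by (subst integral_diff) (auto intro!: integrable_continuous_real continuous_intros c)
    also have "\<dots> = integral {0..t} (j \<circ> (\<lambda>s. S s y))"
    proof (rule integral_cong)
      fix s assume "s \<in> {0..t}"
      then have s: "s \<ge> 0" by simp
      interpret S1s: bounded_linear "S1 s" using s by (rule S1_lin)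
      show "S1 s (A1 x) - \<rho> *\<^sub>R S1 s (B x) = (j \<circ> (\<lambda>s. S s y)) s"
        by (simp add: S1_j[OF s, symmetric] xy[symmetric] S1s.diff S1s.scaleR)
    qed
    also have "\<dots> = j (integral {0..t} (\<lambda>s. S s y))"
      by (intro integral_linear j_lin integrable_continuous_real
        continuous_on_subset[OF contraction_semigroup_continuous[OF S]]) auto
    finally have "S t x - x - \<rho> *\<^sub>R response (\<lambda>_. x) t = integral {0..t} (\<lambda>s. S s y)"
      using inj_j by (simp add: inj_def)
    then show ?thesis
      using V_eq[OF t, of x] by (simp add: V_diff_eq[OF t] scaleR_add_right algebra_simps)
  qed
  have S_int: "norm (integral {0..t} (\<lambda>s. S s y)) \<le> norm y * t" if "t \<ge> 0" for t
    using integral_bound[of 0 t "\<lambda>s. S s y" "norm y"] that S_contr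
      continuous_on_subset[OF contraction_semigroup_continuous[OF S], of "{0..t}" y] by auto
  have small: "norm (?w t) \<le> 2 * norm y * h"
    if h: "0 \<le> h" "h \<le> T" "\<rho> * (C * h powr a) \<le> 1/2" and t: "t \<in> {0..h}" for t h
  proof -
    have "continuous_on {0..h} (\<lambda>t. norm (?w t))"
      by (intro continuous_intros continuous_on_subset[OF w]) auto
    then obtain m where m: "m \<in> {0..h}" "\<And>t. t \<in> {0..h} \<Longrightarrow> norm (?w t) \<le> norm (?w m)"
      using continuous_attains_sup[of "{0..h}" "\<lambda>t. norm (?w t)"] h by auto
    have "norm (?w m) \<le> norm (integral {0..m} (\<lambda>s. S s y)) + norm (\<rho> *\<^sub>R response ?w m)"
      using eq[of m] m(1) norm_triangle_ineq4[of "integral {0..m} (\<lambda>s. S s y)" "\<rho> *\<^sub>R response ?w m"] by simp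
    also have "norm (integral {0..m} (\<lambda>s. S s y)) \<le> norm y * h"
      using S_int[of m] m(1) mult_left_mono[of m h "norm y"] by simp
    also have "norm (\<rho> *\<^sub>R response ?w m) \<le> 1/2 * norm (?w m)"
    proof -
      have "norm (response ?w m) \<le> C * m powr a * norm (?w m)"
        by (intro response_bound_small w) (use m h in auto)
      also have "\<dots> \<le> C * h powr a * norm (?w m)"
        using m(1) C a by (intro mult_right_mono mult_left_mono powr_mono2) auto
      finally have "\<rho> * norm (response ?w m) \<le> \<rho> * (C * h powr a) * norm (?w m)"
        using \<rho> by (simp add: mult.assoc mult_left_mono)
      also have "\<dots> \<le> 1/2 * norm (?w m)" using h by (intro mult_right_mono) auto
      finally show ?thesis using \<rho> by simp
    qed
    finally have "norm (?w m) \<le> 2 * norm y * h" by simp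
    with m(2)[OF t] show ?thesis by simp
  qed
  have powr_0: "((\<lambda>h. \<rho> * (C * h powr a)) \<longlongrightarrow> 0) (at_right 0)"
  proof -
    have "((\<lambda>h. \<rho> * (C * h powr a)) \<longlongrightarrow> \<rho> * (C * 0 powr a)) (at_right 0)"
      using a by (intro tendsto_intros tendsto_powr') (auto simp: eventually_at_right_field intro!: exI[of _ 1])
    then show ?thesis by simp
  qed
  have "((\<lambda>h. (V h x - x) /\<^sub>R h - integral {0..h} (\<lambda>s. S s y) /\<^sub>R h) \<longlongrightarrow> 0) (at_right 0)"
  proof (rule Lim_null_comparison)
    show "((\<lambda>h. \<rho> * (C * h powr a) * (2 * norm y)) \<longlongrightarrow> 0) (at_right 0)"
      using tendsto_mult_right[OF powr_0, of "2 * norm y"] by simp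
    have ev: "\<forall>\<^sub>F h in at_right 0. \<rho> * (C * h powr a) < 1/2"
      by (rule order_tendstoD(2)[OF powr_0]) simp
    have ev2: "\<forall>\<^sub>F h in at_right (0::real). 0 < h \<and> h < T"
      using T by (auto simp: eventually_at_right_field)
    from ev ev2 show "\<forall>\<^sub>F h in at_right 0. norm ((V h x - x) /\<^sub>R h - integral {0..h} (\<lambda>s. S s y) /\<^sub>R h)
        \<le> \<rho> * (C * h powr a) * (2 * norm y)"
    proof eventually_elim
      case (elim h)
      have "(V h x - x) /\<^sub>R h - integral {0..h} (\<lambda>s. S s y) /\<^sub>R h
          = (?w h - integral {0..h} (\<lambda>s. S s y)) /\<^sub>R h"
        by (rule scaleR_diff_right[symmetric])
      also have "?w h - integral {0..h} (\<lambda>s. S s y) = - (\<rho> *\<^sub>R response ?w h)"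
        using eq[of h] elim by (metis add_diff_cancel_left' diff_conv_add_uminus less_imp_le)
      also have "- (\<rho> *\<^sub>R response ?w h) /\<^sub>R h = (- (\<rho> / h)) *\<^sub>R response ?w h"
        by (simp add: divide_inverse mult.commute)
      finally have "norm ((V h x - x) /\<^sub>R h - integral {0..h} (\<lambda>s. S s y) /\<^sub>R h) = \<rho> / h * norm (response ?w h)"
        using \<rho> elim by simp
      also have "\<dots> \<le> \<rho> / h * (C * h powr a * (2 * norm y * h))"
        using elim \<rho> small[of h] by (intro mult_left_mono response_bound_small w) auto
      also have "\<dots> = \<rho> * (C * h powr a) * (2 * norm y)" using elim by simp
      finally show ?case .
    qed
  qed
  moreover have "((\<lambda>h. integral {0..h} (\<lambda>s. S s y) /\<^sub>R h) \<longlongrightarrow> y) (at_right 0)"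
    using integral_average_tendsto[OF contraction_semigroup_continuous[OF S], of y] by (simp add: S_0)
  ultimately have "((\<lambda>h. ((V h x - x) /\<^sub>R h - integral {0..h} (\<lambda>s. S s y) /\<^sub>R h) + integral {0..h} (\<lambda>s. S s y) /\<^sub>R h) \<longlongrightarrow> 0 + y) (at_right 0)"
    by (rule tendsto_add)
  then show "(x, y) \<in> generator V" by (simp add: generator_def)
qed

end

section \<open>Stability\<close>

text \<open>
  For each slope \<open>e > 0\<close>, the largest time at which \<open>g t \<le> g 0 + e t\<close> cannot be smaller than \<open>T\<close>.
\<close>
lemma right_Dini_nonincreasing:
  fixes g :: "real \<Rightarrow> real"
  assumes T: "0 \<le> T" and g: "continuous_on {0..T} g"
    and right: "\<And>t e. 0 \<le> t \<Longrightarrow> t < T \<Longrightarrow> e > 0 \<Longrightarrow> \<forall>\<^sub>F h in at_right 0. g (t + h) \<le> g t + e * h"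
  shows "g T \<le> g 0"
proof -
  have eps: "g T \<le> g 0 + e * T" if e: "e > 0" for e
  proof -
    define Z where "Z = {t \<in> {0..T}. g t \<le> g 0 + e * t}"
    have "closed Z" unfolding Z_def
      by (intro continuous_on_closed_Collect_le continuous_intros g closed_atLeastAtMost)
    moreover have "bounded Z"
      by (rule bounded_subset[of "{0..T}"]) (auto simp: Z_def)
    ultimately have "compact Z" by (simp add: compact_eq_bounded_closed)
    moreover have "0 \<in> Z" using T by (simp add: Z_def)
    ultimately obtain m where m: "m \<in> Z" "\<And>t. t \<in> Z \<Longrightarrow> t \<le> m"
      using compact_attains_sup[of Z] by blast
    have "m = T"
    proof (rule ccontr)
      assume "m \<noteq> T"
      then have mT: "0 \<le> m" "m < T" using m(1) by (auto simp: Z_def)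
      have "\<forall>\<^sub>F h in at_right 0. h < T - m" using mT by (auto simp: eventually_at_right_field intro!: exI[of _ "T - m"])
      moreover have "\<forall>\<^sub>F h in at_right (0::real). 0 < h" by (auto simp: eventually_at_right_field intro!: exI[of _ 1])
      ultimately have "\<forall>\<^sub>F h in at_right 0. m + h \<in> Z \<and> 0 < h"
        using right[OF mT e]
      proof eventually_elim
        case (elim h)
        then show ?case using m(1) mT by (auto simp: Z_def algebra_simps)
      qed
      then obtain h where "m + h \<in> Z" "0 < h"
        using eventually_happens'[OF trivial_limit_at_right_real] by blast
      with m(2) show False by fastforce
    qed
    with m(1) show ?thesis by (simp add: Z_def)
  qed
  then have "g T \<le> g 0 + e" if "e > 0" for e
  proof -
    have "g T \<le> g 0 + e / (T + 1) * T" using that T by (intro eps) auto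
    also have "e / (T + 1) * T \<le> e" using that T by (simp add: field_simps)
    finally show ?thesis by simp
  qed
  then show ?thesis by (rule field_le_epsilon)
qed

text \<open>
  Write \<open>t = k \<tau> + r\<close> with \<open>0 \<le> r < \<tau>\<close>; the factor \<open>2\<close> in the constant accounts for \<open>k > t / \<tau> - 1\<close>.
\<close>
lemma exponential_decay_of_halving:
  fixes V :: "real \<Rightarrow> 'a::chilbert_space \<Rightarrow> 'a"
  assumes V: "C0_semigroup V" and N: "N > 0"
    and growth: "\<And>t x. t \<ge> 0 \<Longrightarrow> norm (V t x) \<le> N * exp t * norm x"
    and \<tau>: "\<tau> > 0" and half: "\<And>x. norm (V \<tau> x) \<le> norm x / 2"
  shows "\<exists>K>0. \<exists>\<sigma>>0. \<forall>x. \<forall>t\<ge>0. norm (V t x) \<le> K * exp (- \<sigma> * t) * norm x"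
proof (intro exI conjI allI impI)
  note V_add = C0_semigroupD(4)[OF V] and V_0 = C0_semigroupD(3)[OF V]
  show "0 < 2 * N * exp \<tau>" "0 < ln 2 / \<tau>" using N \<tau> by auto
  have pow: "norm (V (real k * \<tau>) x) \<le> (1/2)^k * norm x" for k x
  proof (induction k)
    case (Suc k)
    have "V (real (Suc k) * \<tau>) x = V \<tau> (V (real k * \<tau>) x)"
      using V_add[of \<tau> "real k * \<tau>" x] \<tau> by (simp add: algebra_simps)
    then show ?case using half[of "V (real k * \<tau>) x"] Suc by simp
  qed (simp add: V_0)
  fix x and t :: real assume t: "t \<ge> 0"
  define k where "k = nat \<lfloor>t / \<tau>\<rfloor>"
  define r where "r = t - real k * \<tau>"
  have k: "real k \<le> t / \<tau>" "t / \<tau> < real k + 1" using t \<tau> unfolding k_def by (simp_all add: of_nat_nat)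
  then have r: "0 \<le> r" "r \<le> \<tau>" using \<tau> by (auto simp: r_def field_simps)
  have "norm (V t x) = norm (V r (V (real k * \<tau>) x))"
    using V_add[of r "real k * \<tau>" x] r \<tau> by (simp add: r_def)
  also have "\<dots> \<le> N * exp r * norm (V (real k * \<tau>) x)" by (rule growth[OF r(1)])
  also have "\<dots> \<le> N * exp \<tau> * ((1/2)^k * norm x)" using pow r N by (intro mult_mono) auto
  also have "(1/2::real)^k \<le> 2 * exp (- (ln 2 / \<tau>) * t)"
  proof -
    have "(1/2::real)^k = exp (- (real k * ln 2))"
      by (simp add: exp_minus exp_of_nat_mult power_one_over inverse_eq_divide)
    also have "\<dots> \<le> exp (ln 2 - (t / \<tau>) * ln 2)"
    proof -
      have "(t / \<tau>) * ln 2 \<le> (real k + 1) * ln (2::real)" using k by (intro mult_right_mono) auto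
      then show ?thesis by (simp add: algebra_simps)
    qed
    also have "\<dots> = 2 * exp (- (ln 2 / \<tau>) * t)" by (simp add: exp_diff exp_minus field_simps)
    finally show ?thesis .
  qed
  finally show "norm (V t x) \<le> 2 * N * exp \<tau> * exp (- (ln 2 / \<tau>) * t) * norm x"
    using N by (simp add: mult_right_mono mult_left_mono algebra_simps)
qed

text \<open>
  Summing the hypothesis along the orbit and absorbing \<open>\<theta> < \<kappa>\<close> bounds the sum of
  \<open>norm (V(kT)x)\<^sup>2\<close> over \<open>k\<close> by \<open>M norm x\<^sup>2\<close>. In particular the powers of \<open>V T\<close> are bounded,
  so each of the \<open>n\<close> terms \<open>norm (V(kT)x)\<^sup>2\<close> dominates a fixed multiple of \<open>norm (V(nT)x)\<^sup>2\<close>.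
  Hence \<open>n norm (V(nT)x)\<^sup>2\<close> is bounded by a multiple of \<open>norm x\<^sup>2\<close>, and some
  power of \<open>V T\<close> halves the norm.
\<close>
lemma discrete_Datko:
  fixes V :: "real \<Rightarrow> 'a::chilbert_space \<Rightarrow> 'a" and \<phi> :: "'a \<Rightarrow> real"
  assumes V: "C0_semigroup V" and N: "N > 0"
    and growth: "\<And>t x. t \<ge> 0 \<Longrightarrow> norm (V t x) \<le> N * exp t * norm x"
    and T: "T > 0" and \<phi>: "\<And>x. 0 \<le> \<phi> x" "\<And>x. \<phi> x \<le> J * (norm x)\<^sup>2"
    and \<kappa>: "0 \<le> \<theta>" "\<theta> < \<kappa>"
    and step: "\<And>x. \<phi> (V T x) \<le> \<phi> x - \<kappa> * (norm (V T x))\<^sup>2 + \<theta> * (norm x)\<^sup>2"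
  shows "\<exists>K>0. \<exists>\<sigma>>0. \<forall>x. \<forall>t\<ge>0. norm (V t x) \<le> K * exp (- \<sigma> * t) * norm x"
proof -
  note V_add = C0_semigroupD(4)[OF V] and V_0 = C0_semigroupD(3)[OF V]
  define v where "v k x = V (real k * T) x" for k :: nat and x
  have v_add: "v (k + l) x = v k (v l x)" for k l x
    using V_add[of "real k * T" "real l * T" x] T by (simp add: v_def algebra_simps)
  have v_0: "v 0 x = x" for x by (simp add: v_def V_0)
  have v_Suc: "v (Suc k) x = V T (v k x)" for k x
    using v_add[of 1 k x] by (simp add: v_def)
  have telescope: "\<phi> (v n x) + \<kappa> * (\<Sum>k<n. (norm (v (Suc k) x))\<^sup>2) \<le> \<phi> x + \<theta> * (\<Sum>k<n. (norm (v k x))\<^sup>2)" for n x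
  proof (induction n)
    case (Suc n)
    then show ?case using step[of "v n x"] by (simp add: v_Suc algebra_simps)
  qed (simp add: v_0)
  have shift: "(\<Sum>k<n. (norm (v k x))\<^sup>2) \<le> (norm x)\<^sup>2 + (\<Sum>k<n. (norm (v (Suc k) x))\<^sup>2)" for n x
  proof -
    have "(\<Sum>k<n. (norm (v k x))\<^sup>2) \<le> (\<Sum>k<Suc n. (norm (v k x))\<^sup>2)" by simp
    also have "\<dots> = (norm x)\<^sup>2 + (\<Sum>k<n. (norm (v (Suc k) x))\<^sup>2)"
      by (subst sum.lessThan_Suc_shift) (simp add: v_0)
    finally show ?thesis .
  qed
  define M where "M = (\<bar>J\<bar> + \<theta>) / (\<kappa> - \<theta>)"
  have M0: "M \<ge> 0" using \<kappa> by (simp add: M_def)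
  have M: "(\<Sum>k<n. (norm (v (Suc k) x))\<^sup>2) \<le> M * (norm x)\<^sup>2" for n x
  proof -
    let ?s = "\<Sum>k<n. (norm (v (Suc k) x))\<^sup>2"
    have "\<kappa> * ?s \<le> J * (norm x)\<^sup>2 + \<theta> * ((norm x)\<^sup>2 + ?s)"
      using telescope[of n x] \<phi>(1)[of "v n x"] \<phi>(2)[of x] mult_left_mono[OF shift[of x n] \<kappa>(1)] by linarith
    also have "J * (norm x)\<^sup>2 \<le> \<bar>J\<bar> * (norm x)\<^sup>2" by (intro mult_right_mono) auto
    finally have "(\<kappa> - \<theta>) * ?s \<le> (\<bar>J\<bar> + \<theta>) * (norm x)\<^sup>2" by (simp add: algebra_simps)
    then show ?thesis using \<kappa> by (simp add: M_def field_simps)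
  qed
  have bounded: "(norm (v k x))\<^sup>2 \<le> (M + 1) * (norm x)\<^sup>2" for k x
  proof (cases k)
    case 0
    then show ?thesis using M0 by (simp add: v_0 algebra_simps)
  next
    case (Suc l)
    have "(norm (v (Suc l) x))\<^sup>2 \<le> (\<Sum>k<Suc l. (norm (v (Suc k) x))\<^sup>2)"
      by (simp add: sum_nonneg)
    also have "\<dots> \<le> M * (norm x)\<^sup>2" by (rule M)
    also have "\<dots> \<le> (M + 1) * (norm x)\<^sup>2" by (intro mult_right_mono) auto
    finally show ?thesis by (simp add: Suc)
  qed
  have decay: "real n * (norm (v n x))\<^sup>2 \<le> (M + 1) * M * (norm x)\<^sup>2" for n x
  proof -
    have "real n * (norm (v n x))\<^sup>2 = (\<Sum>k<n. (norm (v n x))\<^sup>2)" by simp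
    also have "\<dots> \<le> (\<Sum>k<n. (M + 1) * (norm (v (Suc k) x))\<^sup>2)"
    proof (rule sum_mono)
      fix k assume "k \<in> {..<n}"
      then have "v n x = v (n - Suc k) (v (Suc k) x)" using v_add[of "n - Suc k" "Suc k" x] by simp
      then show "(norm (v n x))\<^sup>2 \<le> (M + 1) * (norm (v (Suc k) x))\<^sup>2" using bounded by metis
    qed
    also have "\<dots> \<le> (M + 1) * (M * (norm x)\<^sup>2)"
      unfolding sum_distrib_left[symmetric] using M0 by (intro mult_left_mono M) auto
    finally show ?thesis by (simp add: mult.assoc)
  qed
  obtain n :: nat where n: "4 * ((M + 1) * M) < real n" using reals_Archimedean2 by blast
  have "0 \<le> (M + 1) * M" using M0 by simp
  with n have "0 < real n" by linarith
  then have npos: "n > 0" by simp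
  have "norm (V (real n * T) x) \<le> norm x / 2" for x
  proof -
    have "real n * (norm (v n x))\<^sup>2 \<le> (M + 1) * M * (norm x)\<^sup>2" by (rule decay)
    also have "\<dots> \<le> real n / 4 * (norm x)\<^sup>2" using n by (intro mult_right_mono) auto
    finally have "(norm (v n x))\<^sup>2 \<le> (norm x / 2)\<^sup>2" using npos by (simp add: power_divide)
    then show ?thesis unfolding v_def by (rule power2_le_imp_le) simp
  qed
  with V N growth show ?thesis
    by (intro exponential_decay_of_halving[of V N "real n * T"]) (use T npos in auto)
qed

context perturbed_semigroup
begin

text \<open>
  Over \<open>[t, t + h]\<close> the orbit arises from \<open>S1(h) j V(t)x\<close>, where contractivity applies, by adding
  the response. This controls increments to the right only, hence the upper right Dini
  derivative of \<open>norm (j (V t x))\<^sup>2\<close>.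
\<close>
lemma energy_inequality:
  "(norm (j (V T x)))\<^sup>2 \<le> (norm (j x))\<^sup>2 - 2 * \<rho> * integral {0..T} (\<lambda>s. inner (B (V s x)) (j (V s x)))"
proof -
  define b where "b s = inner (B (V s x)) (j (V s x))" for s
  define g where "g t = (norm (j (V t x)))\<^sup>2 + 2 * \<rho> * integral {0..t} b" for t
  have b: "continuous_on {0..} b" unfolding b_def
    by (intro continuous_intros bounded_linear.continuous_on[OF B_lin] bounded_linear.continuous_on[OF j_lin] V_continuous_on)
  have bi: "b integrable_on {s..t}" if "s \<ge> 0" for s t
    using that by (intro integrable_continuous_real continuous_on_subset[OF b]) auto
  have "g T \<le> g 0"
  proof (rule right_Dini_nonincreasing)
    show "0 \<le> T" using T by simp
    show "continuous_on {0..T} g" unfolding g_def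
      by (intro continuous_intros indefinite_integral_continuous_1 bi bounded_linear.continuous_on[OF j_lin]
        continuous_on_subset[OF V_continuous_on]) auto
    fix t e :: real assume t: "0 \<le> t" "t < T" and e: "e > 0"
    define z where "z = V t x"
    define P where "P h = j (response (\<lambda>s. V s z) h)" for h
    \<comment> \<open>An upper bound for \<open>(g (t + h) - g t) / h\<close>, which tends to 0 because \<open>P h / h\<close> tends to \<open>B z\<close>.\<close>
    define E where "E h = - (2 * \<rho>) * inner (S1 h (j z)) (P h /\<^sub>R h) + \<rho>\<^sup>2 * (norm (P h) * norm (P h /\<^sub>R h))
      + 2 * \<rho> * (integral {t..t+h} b /\<^sub>R h)" for h
    have P: "((\<lambda>h. P h /\<^sub>R h) \<longlongrightarrow> B z) (at_right 0)"
      unfolding P_def by (rule response_average_tendsto)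
    have id: "((\<lambda>h::real. h) \<longlongrightarrow> 0) (at_right 0)" by (rule tendsto_ident_at)
    have "((\<lambda>h. h *\<^sub>R (P h /\<^sub>R h)) \<longlongrightarrow> 0 *\<^sub>R B z) (at_right 0)"
      by (intro tendsto_scaleR P id)
    then have "((\<lambda>h. h *\<^sub>R (P h /\<^sub>R h)) \<longlongrightarrow> 0) (at_right 0)" by simp
    then have P0: "(P \<longlongrightarrow> 0) (at_right 0)"
      by (rule Lim_transform_eventually) (auto simp: eventually_at_right_field intro!: exI[of _ 1])
    have b_avg: "((\<lambda>h. integral {t..t+h} b /\<^sub>R h) \<longlongrightarrow> b t) (at_right 0)"
      using t by (intro integral_average_tendsto continuous_on_subset[OF b]) auto
    have "(E \<longlongrightarrow> - (2 * \<rho>) * inner (j z) (B z) + \<rho>\<^sup>2 * (norm (0::'b) * norm (B z)) + 2 * \<rho> * b t) (at_right 0)"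
      unfolding E_def
      by (intro tendsto_intros P P0 b_avg C0_semigroupD(5)[OF contraction_semigroupD(1)[OF S1_contraction]])
    then have "(E \<longlongrightarrow> 0) (at_right 0)" by (simp add: b_def z_def inner_commute)
    then have "\<forall>\<^sub>F h in at_right 0. E h < e" using e by (rule order_tendstoD(2))
    moreover have "\<forall>\<^sub>F h in at_right (0::real). 0 < h" by (auto simp: eventually_at_right_field intro!: exI[of _ 1])
    ultimately show "\<forall>\<^sub>F h in at_right 0. g (t + h) \<le> g t + e * h"
    proof eventually_elim
      case (elim h)
      have "V (t + h) x = V h z" using V_add[of h t x] t elim by (simp add: z_def add.commute)
      also have "j \<dots> = S1 h (j z) - \<rho> *\<^sub>R P h"
        using V_eq[of h z] elim
        by (simp add: P_def S1_j linear_diff[OF bounded_linear.linear[OF j_lin]]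
            linear_scale[OF bounded_linear.linear[OF j_lin]])
      finally have jV: "j (V (t + h) x) = S1 h (j z) - \<rho> *\<^sub>R P h" .
      have "(norm (j (V (t + h) x)))\<^sup>2
          = (norm (S1 h (j z)))\<^sup>2 - 2 * \<rho> * inner (S1 h (j z)) (P h) + \<rho>\<^sup>2 * (norm (P h))\<^sup>2"
        unfolding jV power2_norm_eq_inner by (simp add: inner_diff_left inner_diff_right inner_commute power2_eq_square algebra_simps)
      also have "(norm (S1 h (j z)))\<^sup>2 \<le> (norm (j z))\<^sup>2"
        using elim by (intro power_mono S1_contr) auto
      finally have 1: "(norm (j (V (t + h) x)))\<^sup>2
          \<le> (norm (j z))\<^sup>2 - 2 * \<rho> * inner (S1 h (j z)) (P h) + \<rho>\<^sup>2 * (norm (P h))\<^sup>2" by simp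
      have 2: "integral {0..t} b + integral {t..t+h} b = integral {0..t+h} b"
        using t elim by (intro Henstock_Kurzweil_Integration.integral_combine bi) auto
      have 3: "h * E h = - (2 * \<rho>) * inner (S1 h (j z)) (P h) + \<rho>\<^sup>2 * (norm (P h))\<^sup>2 + 2 * \<rho> * integral {t..t+h} b"
        using elim by (simp add: E_def power2_eq_square field_simps)
      have "g (t + h) \<le> g t + h * E h"
        unfolding 3 g_def z_def[symmetric] 2[symmetric] using 1 by (simp add: algebra_simps)
      also have "h * E h \<le> h * e" using elim by (intro mult_left_mono) auto
      finally show ?case by (simp add: mult.commute)
    qed
  qed
  then show ?thesis by (simp add: g_def b_def[abs_def] V_0)
qed

text \<open>
  By \<open>\<rho> gain \<le> 1/2\<close> the constants do not depend on \<open>\<rho>\<close>, apart from the displayed factor.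
\<close>
lemma V_S_diff:
  assumes t: "0 \<le> t" "t \<le> T" and half: "\<rho> * gain \<le> 1/2"
  shows "norm (V t x) \<le> 2 * exp T * norm x" "norm (V t x - S t x) \<le> \<rho> * gain * (2 * exp T * norm x)"
proof -
  have le: "norm (V s x) \<le> 2 * norm x * exp s" if "s \<ge> 0" for s
  proof -
    have "norm (V s x) \<le> norm x / (1 - \<rho> * gain) * exp s" by (rule V_bound[OF that])
    also have "\<dots> \<le> norm x / (1/2) * exp s"
      using half by (intro mult_right_mono divide_left_mono) auto
    finally show ?thesis by simp
  qed
  have e: "norm x * exp t \<le> norm x * exp T" using t by (intro mult_left_mono) auto
  show "norm (V t x) \<le> 2 * exp T * norm x" using le[OF t(1)] e by (simp add: mult_ac)
  have "norm (response (\<lambda>s. V s x) t) \<le> gain * (2 * norm x) * exp t"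
    by (intro response_bound_exp V_continuous_on t le) auto
  also have "\<dots> \<le> gain * (2 * exp T * norm x)"
    using mult_left_mono[OF e, of "2 * gain"] gain by (simp add: algebra_simps)
  finally show "norm (V t x - S t x) \<le> \<rho> * gain * (2 * exp T * norm x)"
    using V_eq[OF t(1), of x] \<rho> by (simp add: mult.assoc mult_left_mono)
qed

text \<open>
  Replacing \<open>V\<close> by \<open>S\<close> in the energy inequality costs \<open>O(\<rho>)\<close> under the integral, hence \<open>O(\<rho>\<^sup>2)\<close>
  after multiplication by \<open>\<rho>\<close>. Half of the dissipation is kept when \<open>norm (S T x)\<^sup>2\<close> is
  replaced by \<open>norm (V T x)\<^sup>2\<close>. The coefficient of \<open>\<rho>\<^sup>2\<close> must be independent of \<open>\<rho>\<close>, which is why it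
  is displayed.
\<close>
lemma Lyapunov_step:
  assumes half: "\<rho> * gain \<le> 1/2"
    and \<delta>: "\<delta> > 0" "\<And>x. integral {0..T} (\<lambda>t. inner (B (S t x)) (j (S t x))) \<ge> \<delta> * (norm (S T x))\<^sup>2"
    and \<beta>: "\<beta> \<ge> 0" "\<And>x y. \<bar>inner (B x) (j y)\<bar> \<le> \<beta> * norm x * norm y"
    and M: "M = 2 * exp T"
  shows "(norm (j (V T x)))\<^sup>2 \<le> (norm (j x))\<^sup>2 - \<rho> * \<delta> * (norm (V T x))\<^sup>2
    + \<rho>\<^sup>2 * (2 * T * \<beta> * gain * M * (M + 1) + \<delta> * gain * M\<^sup>2) * (norm x)\<^sup>2"
proof -
  let ?n = "norm x" and ?D = "\<rho> * gain * (M * norm x)"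
  have M0: "M \<ge> 1" using T one_le_exp_iff[of T] unfolding M by linarith
  have V_le: "norm (V t x) \<le> M * ?n" and D: "norm (V t x - S t x) \<le> ?D" if "t \<in> {0..T}" for t
    using V_S_diff[OF _ _ half, of t x] that by (auto simp: M)
  have D0: "0 \<le> ?D" using \<rho> gain M0 by simp
  interpret B: bounded_linear B by (rule B_lin)
  interpret j: bounded_linear j by (rule j_lin)
  let ?v = "\<lambda>t. inner (B (V t x)) (j (V t x))" and ?s = "\<lambda>t. inner (B (S t x)) (j (S t x))"
  have S_cont: "continuous_on {0..T} (\<lambda>t. S t x)"
    by (rule continuous_on_subset[OF contraction_semigroup_continuous[OF S]]) auto
  have V_cont: "continuous_on {0..T} (\<lambda>t. V t x)"
    by (rule continuous_on_subset[OF V_continuous_on]) auto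
  have v: "continuous_on {0..T} ?v" and s: "continuous_on {0..T} ?s"
    by (intro continuous_intros B.continuous_on j.continuous_on S_cont V_cont)+
  have "norm (integral {0..T} (\<lambda>t. ?v t - ?s t)) \<le> \<beta> * ?D * (M + 1) * ?n * (T - 0)"
  proof (rule integral_bound)
    fix t assume t: "t \<in> {0..T}"
    have "?v t - ?s t = inner (B (V t x - S t x)) (j (V t x)) + inner (B (S t x)) (j (V t x - S t x))"
      by (simp add: B.diff j.diff inner_diff_left inner_diff_right)
    then have "norm (?v t - ?s t) \<le> \<beta> * norm (V t x - S t x) * norm (V t x) + \<beta> * norm (S t x) * norm (V t x - S t x)"
      using \<beta>(2)[of "V t x - S t x" "V t x"] \<beta>(2)[of "S t x" "V t x - S t x"] by simp
    also have "\<dots> \<le> \<beta> * ?D * (M * ?n) + \<beta> * ?n * ?D"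
      using \<beta>(1) V_le[OF t] D[OF t] D0 S_contr[of t x] t
      by (intro add_mono mult_mono) (auto simp del: mult_nonneg_nonneg intro: mult_nonneg_nonneg[OF \<beta>(1)])
    finally show "norm (?v t - ?s t) \<le> \<beta> * ?D * (M + 1) * ?n" by (simp add: algebra_simps)
  qed (use T in \<open>auto intro!: continuous_intros v s\<close>)
  moreover have "integral {0..T} (\<lambda>t. ?v t - ?s t) = integral {0..T} ?v - integral {0..T} ?s"
    by (intro integral_diff integrable_continuous_real v s)
  ultimately have "integral {0..T} ?v \<ge> \<delta> * (norm (S T x))\<^sup>2 - \<beta> * ?D * (M + 1) * ?n * T"
    using \<delta>(2)[of x] by (simp add: abs_le_iff)
  then have "2 * \<rho> * integral {0..T} ?v \<ge> 2 * \<rho> * (\<delta> * (norm (S T x))\<^sup>2 - \<beta> * ?D * (M + 1) * ?n * T)"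
    using \<rho> by (intro mult_left_mono) auto
  with energy_inequality[of x]
  have 1: "(norm (j (V T x)))\<^sup>2 \<le> (norm (j x))\<^sup>2 - 2 * \<rho> * \<delta> * (norm (S T x))\<^sup>2 + 2 * \<rho> * (\<beta> * ?D * (M + 1) * ?n * T)"
    by (simp add: algebra_simps)
  have "(norm (V T x))\<^sup>2 \<le> 2 * (norm (S T x))\<^sup>2 + 2 * ?D\<^sup>2"
  proof -
    have "norm (V T x) \<le> norm (S T x) + ?D"
      using norm_triangle_ineq2[of "V T x" "S T x"] D[of T] T by simp
    then have "(norm (V T x))\<^sup>2 \<le> (norm (S T x) + ?D)\<^sup>2" by (intro power_mono) auto
    also have "\<dots> \<le> 2 * (norm (S T x))\<^sup>2 + 2 * ?D\<^sup>2" 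
      using zero_le_power2[of "norm (S T x) - ?D"] by (simp add: power2_sum power2_diff)
    finally show ?thesis .
  qed
  moreover have "2 * ?D\<^sup>2 \<le> \<rho> * gain * M\<^sup>2 * ?n\<^sup>2"
  proof -
    have "2 * ?D\<^sup>2 = (2 * (\<rho> * gain)) * (\<rho> * gain * M\<^sup>2 * ?n\<^sup>2)" by (simp add: power2_eq_square algebra_simps)
    also have "\<dots> \<le> 1 * (\<rho> * gain * M\<^sup>2 * ?n\<^sup>2)"
      using half \<rho> gain by (intro mult_right_mono) auto
    finally show ?thesis by simp
  qed
  ultimately have "\<rho> * \<delta> * (norm (V T x))\<^sup>2 \<le> \<rho> * \<delta> * (2 * (norm (S T x))\<^sup>2 + \<rho> * gain * M\<^sup>2 * ?n\<^sup>2)"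
    using \<rho> \<delta>(1) by (intro mult_left_mono) auto
  with 1 show ?thesis by (simp add: power2_eq_square algebra_simps)
qed

end

lemma (in bounded_input) exponentially_stable_small_perturbation:
  assumes \<delta>: "\<delta> > 0" "\<And>x. integral {0..T} (\<lambda>t. inner (B (S t x)) (j (S t x))) \<ge> \<delta> * (norm (S T x))\<^sup>2"
  shows "\<exists>\<rho>1>0. \<forall>\<rho>. 0 < \<rho> \<and> \<rho> < \<rho>1 \<longrightarrow> exponentially_stable j (\<lambda>x. A1 x - \<rho> *\<^sub>R B x)"
proof -
  obtain KB where KB: "KB > 0" "\<And>x. norm (B x) \<le> norm x * KB"
    using bounded_linear.pos_bounded[OF B_lin] by blast
  obtain J where J: "J > 0" "\<And>x. norm (j x) \<le> norm x * J"
    using bounded_linear.pos_bounded[OF j_lin] by blast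
  define \<beta> where "\<beta> = KB * J"
  have \<beta>: "\<beta> \<ge> 0" "\<bar>inner (B x) (j y)\<bar> \<le> \<beta> * norm x * norm y" for x y
  proof -
    show "\<beta> \<ge> 0" using KB J by (simp add: \<beta>_def)
    have "\<bar>inner (B x) (j y)\<bar> \<le> norm (B x) * norm (j y)" by (rule Cauchy_Schwarz_ineq2)
    also have "\<dots> \<le> (norm x * KB) * (norm y * J)" using KB J by (intro mult_mono) auto
    finally show "\<bar>inner (B x) (j y)\<bar> \<le> \<beta> * norm x * norm y" by (simp add: \<beta>_def mult_ac)
  qed
  define M where "M = 2 * exp T"
  define L where "L = 2 * T * \<beta> * gain * M * (M + 1) + \<delta> * gain * M\<^sup>2"
  have L: "L > 0" using T \<beta>(1) gain \<delta>(1) by (simp add: L_def M_def add_nonneg_pos)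
  show ?thesis
  proof (intro exI[of _ "min (1 / (2 * gain)) (\<delta> / L)"] conjI allI impI)
    show "0 < min (1 / (2 * gain)) (\<delta> / L)" using gain \<delta>(1) L by simp
    fix \<rho> assume "0 < \<rho> \<and> \<rho> < min (1 / (2 * gain)) (\<delta> / L)"
    then have small: "0 < \<rho>" "\<rho> * gain < 1/2" "\<rho> * L < \<delta>"
      using gain L by (auto simp: field_simps)
    interpret perturbed_semigroup S \<mu> j A1 S1 B T C a \<rho>
      by unfold_locales (use small in linarith)+
    have "\<exists>K>0. \<exists>\<sigma>>0. \<forall>x. \<forall>t\<ge>0. norm (V t x) \<le> K * exp (- \<sigma> * t) * norm x"
    proof (rule discrete_Datko[OF V_C0_semigroup _ _ T, where \<phi> = "\<lambda>x. (norm (j x))\<^sup>2"])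
      show "0 < 1 / (1 - \<rho> * gain)" using small by simp
      show "norm (V t x) \<le> 1 / (1 - \<rho> * gain) * exp t * norm x" if "t \<ge> 0" for t x
        using V_bound[OF that, of x] by (simp add: mult.commute)
      show "(norm (j x))\<^sup>2 \<le> J\<^sup>2 * (norm x)\<^sup>2" for x
        using power_mono[OF J(2)[of x] norm_ge_zero, of 2] by (simp add: power_mult_distrib mult.commute)
      show "0 \<le> \<rho>\<^sup>2 * L" using L by simp
      show "\<rho>\<^sup>2 * L < \<rho> * \<delta>" using small by (simp add: power2_eq_square mult.assoc)
      show "(norm (j (V T x)))\<^sup>2 \<le> (norm (j x))\<^sup>2 - \<rho> * \<delta> * (norm (V T x))\<^sup>2 + \<rho>\<^sup>2 * L * (norm x)\<^sup>2" for x
        unfolding L_def using small by (intro Lyapunov_step \<delta> \<beta> M_def) auto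
    qed simp
    then show "exponentially_stable j (\<lambda>x. A1 x - \<rho> *\<^sub>R B x)"
      unfolding exponentially_stable_def using V_C0_semigroup V_generator by blast
  qed
qed

theorem mainTheorem1:
  fixes S :: "real \<Rightarrow> 'a::chilbert_space \<Rightarrow> 'a"
    and A :: "('a \<times> 'a) set"
    and \<mu> :: complex
    and j :: "'a \<Rightarrow> 'b::chilbert_space"
    and S1 :: "real \<Rightarrow> 'b \<Rightarrow> 'b"
    and A1 B :: "'a \<Rightarrow> 'b"
    and B_adj :: "'b \<Rightarrow> 'a"
    and T :: real
  assumes "contraction_semigroup S"
    and "A = generator S"
    and "\<mu> \<in> resolvent_set A"
    and "extrapolation_space A \<mu> j"
    and "extends_operator j A A1"
    and "extends_semigroup j S S1"
    and "bounded_clinear B"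
    and "is_cadjoint B B_adj"
    and "T > 0"
    and "\<exists>p>1. admissible j S1 B p T"
    and "\<exists>\<delta>>0. \<forall>x. integral {0..T} (\<lambda>t. Re (cinner (S t x) (B_adj (j (S t x)))))
                  \<ge> \<delta> * (norm (S T x))\<^sup>2"
  shows "\<exists>\<rho>1>0. \<forall>\<rho>. 0 < \<rho> \<and> \<rho> < \<rho>1 \<longrightarrow>
           exponentially_stable j (\<lambda>x. A1 x - \<rho> *\<^sub>R B x)"
proof -
  obtain p where p: "p > 1" "admissible j S1 B p T" using assms(10) by blast
  obtain \<delta> where \<delta>: "\<delta> > 0"
    "\<And>x. integral {0..T} (\<lambda>t. Re (cinner (S t x) (B_adj (j (S t x))))) \<ge> \<delta> * (norm (S T x))\<^sup>2"
    using assms(11) by blast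
  have adj: "Re (cinner (S t x) (B_adj (j (S t x)))) = inner (B (S t x)) (j (S t x))" for t x
    using assms(8) by (simp add: is_cadjoint_def Re_cinner[symmetric])
  interpret admissible_perturbation S \<mu> j A1 S1 B p T
    by unfold_locales (use assms p in auto)
  obtain C where C: "C > 0" "\<And>g t M. 0 \<le> t \<Longrightarrow> t \<le> T \<Longrightarrow> continuous_on {0..t} g \<Longrightarrow>
      (\<And>r. r \<in> {0..t} \<Longrightarrow> norm (g r) \<le> M) \<Longrightarrow>
      \<exists>y. j y = integral {0..t} (\<lambda>r. S1 r (B (g r))) \<and> norm y \<le> C * t powr weight * M"
    using input_integral_bound by blast
  interpret bounded_input S \<mu> j A1 S1 B T C weight
    by unfold_locales (use assms C weight in auto)
  show ?thesis using exponentially_stable_small_perturbation[OF \<delta>(1)] \<delta>(2) by (simp add: adj)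
qed

end
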